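(* Let $r_1$ be a root of $p(x)=x^4-10x^3-5x^2+6x+1$ in $[\tfrac{175013}{262144},\tfrac{21877}{32768}]$ and $r_2=\sqrt{r_1}$ (the root of $x^2-r_1$ in $[\tfrac{13387}{16384},\tfrac{6695}{8192}]$), and let $\ell=\ell(r_2,1)=\Big(1,\sqrt{1+\tfrac{1}{r_2^2+1}},\sqrt{1+\tfrac{r_2^2}{r_2^2+1}}\Big)$. For $n\in\mathbb{N}_0$, let $X$ be the wild-coloured multi-tetrahedral sphere corresponding to the double tetra-helix $\mathcal{D}_{11+12n}^{\ell}$ and let $\phi$ be a strong $\ell$-embedding of $X$. Then there exist the two vertices $v,w$ of degree $3$ of $X$ and faces $f_v\ni v$, $f_w\ni w$ such that $(X,v,w,f_v,f_w,\phi)$ satisfies property (T1).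
   Context: $\Lambda$ is the set of triples of positive reals satisfying the (non-strict) triangle inequalities. A tetrahedron is wild if its four faces are congruent triangles with side lengths $(a,b,c)\in\Lambda$; in a wild tetrahedron opposite edges have equal length. A cluster of wild tetrahedra is a sequence $(T_1,\dots,T_n)$ of pairwise distinct wild tetrahedra such that each $T_j$, $j\ge2$, shares exactly one face with some $T_i$, $i<j$; a chain if $T_i,T_{i+1}$ share a face for all $i$. Tetra-symbol: a tetra-colouring of a cluster colours its vertices with $\{1,2,3,4\}$ bijectively on each tetrahedron. The symbol $((m_1)_{k_1}\cdots(m_{n-1})_{k_{n-1}})^{(a,b,c)}$ describes the cluster of wild tetrahedra with face side lengths $(a,b,c)$ in which, for each $i$, the tetrahedron $T_{i+1}$ is obtained by attaching a new wild tetrahedron to $T_{m_i}$ along the face of $T_{m_i}$ not containing the vertex of colour $k_i$ (the new vertex, which receives colour $k_i$, is the reflection of that vertex of $T_{m_i}$ in the plane of the shared face). The double tetra-helix $\mathcal{D}_{2k+1}^{(a,b,c)}$ is the chain given by the symbol $\big(1_1 1_2\prod_{i=1}^{2(k-1)}(t_i)_{f_i}\big)^{(a,b,c)}$ with $t_i=i+1$ and $(f_i)$ the $8$-periodic sequence $4,4,2,1,3,3,1,2,4,4,2,1,\dots$. (E.g. $\mathcal{D}_7$: $(1_11_22_43_44_25_1)$.) Simplicial surface: a set $X$ of nonempty subsets of a finite set, closed under nonempty subsets, with elements of size $\le 3$ (vertices, edges, faces), each edge in exactly two faces, and the faces around each vertex (at least $3$, their number being the degree) forming one cycle in which consecutive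 faces share an edge. A wild-colouring maps edges to $\{1,2,3\}$ bijectively on each face. For $(\ell_1,\ell_2,\ell_3)\in\Lambda$, a strong $(\ell_1,\ell_2,\ell_3)$-embedding is an injective map $\phi$ from vertices to $\mathbb{R}^3$ with $\|\phi(u)-\phi(u')\|=\ell_p$ for each edge $\{u,u'\}$ of colour $p$. For a cluster $\tau$, $X_\tau$ has as vertices the vertices of the $T_i$, edges the vertex pairs spanning an edge of some $T_i$, faces the vertex triples spanning a face lying in exactly one $T_i$; the multi-tetrahedral sphere corresponding to $\tau$ is $X_\tau$ (Euler characteristic $2$), wild-coloured by the edge lengths. If $\tau$ is a chain it has exactly two vertices of degree $3$. Property (T1): let $v,w$ be the two degree-$3$ vertices, $f_v=\{v,v_2,v_3\}$, $f_w=\{w,w_2,w_3\}$, $\hat n$ a nonzero vector orthogonal to $\phi(v_2)-\phi(v)$ and $\phi(v_3)-\phi(v)$, and write each vertex as $\phi(v')=\phi(v)+r_{v'}(\phi(v_2)-\phi(v))+s_{v'}(\phi(v_3)-\phi(v))+t_{v'}\hat n$. Then (T1) holds if (1) with $P=\phi(v)+\langle\phi(v_2)-\phi(v),\phi(v_3)-\phi(v)\rangle$, $\{v'\mid\phi(v')\in P\}=\{v,v_2,v_3,w,w_2,w_3\}$; (2) every edge $e$ with $\mathrm{conv}(\phi(e))\subseteq P$ is an edge of $f_v$ or $f_w$; (3) the set $\{(r_{v'},s_{v'},|t_{v'}|)\}$ over all vertices $v'$ has as many elements as there are vertices.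
   Formalization: The symbol does not say which colour pairs carry which edge lengths; here edges coloured {1,2} and {3,4} have the second length of ℓ, the other two lengths being assigned either way. With the first length on {1,2},{3,4} the claim already fails for n=0. *)

theory Defs
  imports "HOL-Analysis.Analysis"
begin

type_synonym point = "real^3"

subsection \<open>Wild tetrahedra and clusters\<close>

text \<open>A tetrahedron is represented by its set of vertices.\<close>

definition tetrahedron :: "point set \<Rightarrow> bool" where
  "tetrahedron S \<longleftrightarrow> card S = 4 \<and> \<not> affine_dependent S"

definition tet_edges :: "point set \<Rightarrow> point set set" where
  "tet_edges S = {e. e \<subseteq> S \<and> card e = 2}"

definition tet_faces :: "point set \<Rightarrow> point set set" where
  "tet_faces S = {F. F \<subseteq> S \<and> card F = 3}"

definition Lambda :: "(real \<times> real \<times> real) set" where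
  "Lambda = {(a, b, c). 0 < a \<and> 0 < b \<and> 0 < c \<and> a \<le> b + c \<and> b \<le> a + c \<and> c \<le> a + b}"

definition triangle_with_sides :: "real \<times> real \<times> real \<Rightarrow> point set \<Rightarrow> bool" where
  "triangle_with_sides l F \<longleftrightarrow>
     (\<exists>x y z. F = {x, y, z} \<and> (dist y z, dist x z, dist x y) = l)"

definition wild_tetrahedron :: "real \<times> real \<times> real \<Rightarrow> point set \<Rightarrow> bool" where
  "wild_tetrahedron l S \<longleftrightarrow>
     l \<in> Lambda \<and> tetrahedron S \<and> (\<forall>F\<in>tet_faces S. triangle_with_sides l F)"

definition wild_cluster :: "point set list \<Rightarrow> bool" where
  "wild_cluster T \<longleftrightarrow>
     distinct T \<and> (\<forall>S\<in>set T. \<exists>l. wild_tetrahedron l S) \<and>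
     (\<forall>j. 1 \<le> j \<and> j < length T \<longrightarrow>
        (\<exists>i<j. \<exists>!F. F \<in> tet_faces (T ! i) \<and> F \<in> tet_faces (T ! j)))"

subsection \<open>Tetra-symbols\<close>

definition tetra_colouring :: "point set list \<Rightarrow> (point \<Rightarrow> nat) \<Rightarrow> bool" where
  "tetra_colouring T c \<longleftrightarrow> (\<forall>S\<in>set T. bij_betw c S {1, 2, 3, 4})"

definition reflect_in :: "point set \<Rightarrow> point \<Rightarrow> point" where
  "reflect_in A x = 2 *\<^sub>R closest_point A x - x"

text \<open>
  A symbol is the list of pairs \<open>(m, k)\<close>, where \<open>m\<close> counts tetrahedra from 1 although
  list positions count from 0: entry \<open>i\<close> of the list produces \<open>T ! (i + 1)\<close> from \<open>T ! (m - 1)\<close>.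

  A symbol fixes a cluster only once it is known which edge lengths belong to which pairs of
  colours. The convention here is that edges with colours \<open>{1,2}\<close> or \<open>{3,4}\<close> have the second
  length \<open>b\<close>. Which of \<open>{1,3}, {2,4}\<close> and \<open>{1,4}, {2,3}\<close> carries \<open>a\<close> and which carries \<open>c\<close> is left
  open; for the double tetra-helix the two choices are exchanged by swapping the colours 1 and 2
  and give the same set of tetrahedra.
\<close>

definition described_by ::
  "(nat \<times> nat) list \<Rightarrow> real \<times> real \<times> real \<Rightarrow> point set list \<Rightarrow> (point \<Rightarrow> nat) \<Rightarrow> bool" where
  "described_by ss l T c \<longleftrightarrow>
     wild_cluster T \<and> (\<forall>S\<in>set T. wild_tetrahedron l S) \<and> tetra_colouring T c \<and>
     (\<forall>S\<in>set T. \<forall>x\<in>S. \<forall>y\<in>S. {c x, c y} = {1, 2} \<or> {c x, c y} = {3, 4} \<longrightarrow>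
        dist x y = fst (snd l)) \<and>
     length T = length ss + 1 \<and>
     (\<forall>i<length ss. \<forall>m k. ss ! i = (m, k) \<longrightarrow>
        1 \<le> m \<and> m \<le> i + 1 \<and>
        (\<exists>x\<in>T ! (m - 1). \<exists>y. c x = k \<and> c y = k \<and>
           y = reflect_in (affine hull (T ! (m - 1) - {x})) x \<and>
           T ! (i + 1) = insert y (T ! (m - 1) - {x})))"

text \<open>The symbol of \<open>D\<^bsub>2k+1\<^esub>\<close>.\<close>

definition double_tetra_helix :: "nat \<Rightarrow> (nat \<times> nat) list" where
  "double_tetra_helix k =
     [(1, 1), (1, 2)] @
     map (\<lambda>i. (i + 1, [4, 4, 2, 1, 3, 3, 1, 2] ! ((i - 1) mod 8))) [1..<2 * (k - 1) + 1]"

subsection \<open>Wild-coloured complexes and strong embeddings\<close>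

text \<open>As for simplicial surfaces, a complex is the set of its vertices \<open>{x}\<close>, edges and faces.\<close>

definition vertices :: "'a set set \<Rightarrow> 'a set" where
  "vertices X = {x. {x} \<in> X}"

definition edges :: "'a set set \<Rightarrow> 'a set set" where
  "edges X = {e \<in> X. card e = 2}"

definition faces :: "'a set set \<Rightarrow> 'a set set" where
  "faces X = {f \<in> X. card f = 3}"

definition degree :: "'a set set \<Rightarrow> 'a \<Rightarrow> nat" where
  "degree X x = card {f \<in> faces X. x \<in> f}"

definition wild_colouring :: "'a set set \<Rightarrow> ('a set \<Rightarrow> nat) \<Rightarrow> bool" where
  "wild_colouring X \<omega> \<longleftrightarrow>
     (\<forall>e\<in>edges X. \<omega> e \<in> {1, 2, 3}) \<and>
     (\<forall>f\<in>faces X. bij_betw \<omega> {e \<in> edges X. e \<subseteq> f} {1, 2, 3})"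

definition length_of_colour :: "real \<times> real \<times> real \<Rightarrow> nat \<Rightarrow> real" where
  "length_of_colour l p =
     (case l of (a, b, c) \<Rightarrow> if p = 1 then a else if p = 2 then b else c)"

definition has_edge_lengths ::
  "'a set set \<Rightarrow> ('a set \<Rightarrow> nat) \<Rightarrow> real \<times> real \<times> real \<Rightarrow> ('a \<Rightarrow> point) \<Rightarrow> bool" where
  "has_edge_lengths X \<omega> l \<phi> \<longleftrightarrow>
     (\<forall>u u'. {u, u'} \<in> edges X \<longrightarrow> norm (\<phi> u - \<phi> u') = length_of_colour l (\<omega> {u, u'}))"

definition strong_embedding ::
  "'a set set \<Rightarrow> ('a set \<Rightarrow> nat) \<Rightarrow> real \<times> real \<times> real \<Rightarrow> ('a \<Rightarrow> point) \<Rightarrow> bool" where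
  "strong_embedding X \<omega> l \<phi> \<longleftrightarrow>
     l \<in> Lambda \<and> inj_on \<phi> (vertices X) \<and> has_edge_lengths X \<omega> l \<phi>"

definition multi_tetrahedral_sphere :: "point set list \<Rightarrow> point set set" where
  "multi_tetrahedral_sphere T =
     {{x} | x. \<exists>S\<in>set T. x \<in> S} \<union>
     {e. \<exists>S\<in>set T. e \<in> tet_edges S} \<union>
     {F. \<exists>!i. i < length T \<and> F \<in> tet_faces (T ! i)}"

definition wild_coloured_by_lengths ::
  "point set set \<Rightarrow> real \<times> real \<times> real \<Rightarrow> (point set \<Rightarrow> nat) \<Rightarrow> bool" where
  "wild_coloured_by_lengths X l \<omega> \<longleftrightarrow> wild_colouring X \<omega> \<and> has_edge_lengths X \<omega> l (\<lambda>x. x)"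

subsection \<open>Property (T1)\<close>

definition property_T1 ::
  "'a set set \<Rightarrow> 'a \<Rightarrow> 'a \<Rightarrow> 'a set \<Rightarrow> 'a set \<Rightarrow> ('a \<Rightarrow> point) \<Rightarrow> bool" where
  "property_T1 X v w fv fw \<phi> \<longleftrightarrow>
     v \<noteq> w \<and> {x \<in> vertices X. degree X x = 3} = {v, w} \<and>
     fv \<in> faces X \<and> v \<in> fv \<and> fw \<in> faces X \<and> w \<in> fw \<and>
     (\<exists>v2 v3 w2 w3 nv r s t P.
        fv = {v, v2, v3} \<and> fw = {w, w2, w3} \<and>
        nv \<noteq> 0 \<and> orthogonal nv (\<phi> v2 - \<phi> v) \<and> orthogonal nv (\<phi> v3 - \<phi> v) \<and>
        (\<forall>x\<in>vertices X.
           \<phi> x = \<phi> v + r x *\<^sub>R (\<phi> v2 - \<phi> v) + s x *\<^sub>R (\<phi> v3 - \<phi> v) + t x *\<^sub>R nv) \<and>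
        P = (+) (\<phi> v) ` span {\<phi> v2 - \<phi> v, \<phi> v3 - \<phi> v} \<and>
        {x \<in> vertices X. \<phi> x \<in> P} = {v, v2, v3, w, w2, w3} \<and>
        (\<forall>e\<in>edges X. convex hull (\<phi> ` e) \<subseteq> P \<longrightarrow> e \<subseteq> fv \<or> e \<subseteq> fw) \<and>
        card ((\<lambda>x. (r x, s x, \<bar>t x\<bar>)) ` vertices X) = card (vertices X))"

end

theory Submission
  imports Defs
begin

text \<open>
  From the first tetrahedron the chain runs off in two helical branches, in which every fourth point
  is the reflection of the point four places before it in the plane of the three points between.
  Hence each branch satisfies a linear recurrence, whose coefficients depend on the edge lengths
  through two numbers \<open>x\<close> and \<open>y\<close>. The quartic equation for \<open>r\<^sub>1\<close> says exactly that \<open>x * y = 1\<close>, and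
  then six steps of the recurrence are a translation, with the same component normal to the common
  face \<open>{1, 2, 4}\<close> of the first tetrahedron for both branches. So after \<open>6 * n + 6\<close> steps both branches
  have reached the same plane parallel to that face, and all other vertices lie strictly on one side
  of it. A strong embedding is isometric on tetrahedra and injective, which forces each new point to
  be the reflection, so the embedded points satisfy the same recurrence.
\<close>

section \<open>Disphenoids\<close>

text \<open>With \<open>X\<close>, \<open>Y\<close>, \<open>Z\<close> the squared sides of the box
  around a tetrahedron and \<open>S\<close> the sum of their reciprocals,
  \<open>x = 4 / (S * X)\<close> and \<open>y = 4 / (S * Z)\<close>; the third weight
  \<open>4 / (S * Y)\<close> equals \<open>4 - x - y\<close>. Two steps along a branch form one
  screw motion, since windows whose indices have equal parity are congruent in order. Its trace on
  the affine functions is \<open>x * y\<close> by the recurrence and 2 + 2 cos(theta) by geometry,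
  where theta is the angle of rotation. So \<open>x * y = 1\<close> says that theta is 120 degrees,
  and three such motions are a translation. The branches exchange \<open>x\<close> and
  \<open>y\<close>, but the climb over six steps, \<open>4 - x - y\<close> times the height of point
  3, is symmetric in them. Heights neither tell the branches apart nor the three points at a common
  height. The former takes a second linear functional and numerical bounds, for which the interval
  around the root is used; the latter takes the edge lengths.\<close>

lemma orthogonal_to_triple_eq_0:
  fixes X Y Z d :: "real^3"
  assumes "X \<noteq> 0" "Y \<noteq> 0" "Z \<noteq> 0" "X \<bullet> Y = 0" "X \<bullet> Z = 0" "Y \<bullet> Z = 0"
    and "d \<bullet> X = 0" "d \<bullet> Y = 0" "d \<bullet> Z = 0"
  shows "d = 0"
proof (rule ccontr)
  assume "d \<noteq> 0"
  have "d \<noteq> X" "d \<noteq> Y" "d \<noteq> Z" "X \<noteq> Y" "X \<noteq> Z" "Y \<noteq> Z"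
    using assms \<open>d \<noteq> 0\<close> by auto
  then have "card {d, X, Y, Z} = 4" by simp
  moreover have "pairwise orthogonal {d, X, Y, Z}"
    using assms by (auto simp: pairwise_def orthogonal_def inner_commute)
  then have "independent {d, X, Y, Z}"
    using assms \<open>d \<noteq> 0\<close> by (intro pairwise_orthogonal_independent) auto
  then have "card {d, X, Y, Z} \<le> DIM(real^3)"
    using independent_bound by blast
  ultimately show False by simp
qed

text \<open>
  A disphenoid sits in a box whose face diagonals are its edges; \<open>X\<close>, \<open>Y\<close>, \<open>Z\<close> are the squared
  sides of that box.
\<close>

definition disphenoid :: "real \<Rightarrow> real \<Rightarrow> real \<Rightarrow> point \<Rightarrow> point \<Rightarrow> point \<Rightarrow> point \<Rightarrow> bool" where
  "disphenoid X Y Z x u v w \<longleftrightarrow> 0 < X \<and> 0 < Y \<and> 0 < Z \<and>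
     (dist x u)\<^sup>2 = Y + Z \<and> (dist x v)\<^sup>2 = X + Z \<and> (dist x w)\<^sup>2 = X + Y \<and>
     (dist u v)\<^sup>2 = X + Y \<and> (dist u w)\<^sup>2 = X + Z \<and> (dist v w)\<^sup>2 = Y + Z"

lemma disphenoid_inner:
  assumes "disphenoid X Y Z x u v w"
  shows "(u - x) \<bullet> (u - x) = Y + Z" "(v - x) \<bullet> (v - x) = X + Z" "(w - x) \<bullet> (w - x) = X + Y"
    "(u - x) \<bullet> (v - x) = Z" "(u - x) \<bullet> (w - x) = Y" "(v - x) \<bullet> (w - x) = X"
  using assms
  unfolding disphenoid_def dist_norm power2_norm_eq_inner
  by (auto simp: inner_diff_left inner_diff_right inner_commute algebra_simps)

text \<open>The bimedians of a disphenoid are orthogonal: they are parallel to the sides of the box.\<close>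

lemma disphenoid_orthogonal_eq_0:
  assumes "disphenoid X Y Z x u v w"
    and "d \<bullet> (u - x) = 0" "d \<bullet> (v - x) = 0" "d \<bullet> (w - x) = 0"
  shows "d = 0"
proof -
  note inn = disphenoid_inner[OF assms(1)]
  have pos: "X > 0" "Y > 0" "Z > 0" using assms(1) by (auto simp: disphenoid_def)
  define e f g where "e = u - x" and "f = v - x" and "g = w - x"
  note efg = e_def[symmetric] f_def[symmetric] g_def[symmetric]
  note inn = inn[unfolded efg]
  have sq: "(f + g - e) \<bullet> (f + g - e) = 4 * X" "(e + g - f) \<bullet> (e + g - f) = 4 * Y"
    "(e + f - g) \<bullet> (e + f - g) = 4 * Z"
    using inn by (auto simp: inner_diff_left inner_diff_right inner_add_left inner_add_right
        inner_commute algebra_simps)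
  have "f + g - e \<noteq> 0" "e + g - f \<noteq> 0" "e + f - g \<noteq> 0"
    using sq pos by force+
  moreover have "(f + g - e) \<bullet> (e + g - f) = 0" "(f + g - e) \<bullet> (e + f - g) = 0"
    "(e + g - f) \<bullet> (e + f - g) = 0"
    using inn by (auto simp: inner_diff_left inner_diff_right inner_add_left inner_add_right
        inner_commute algebra_simps)
  moreover have "d \<bullet> (f + g - e) = 0" "d \<bullet> (e + g - f) = 0" "d \<bullet> (e + f - g) = 0"
    using assms(2-4)[unfolded efg] by (auto simp: inner_diff_right inner_add_right)
  ultimately show "d = 0" by (rule orthogonal_to_triple_eq_0)
qed

text \<open>A disphenoid is nondegenerate, so an affine function can be prescribed freely at its
  vertices. Heights, the functional separating the branches and the independence of two edges are
  all obtained from this.\<close>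

lemma disphenoid_functional:
  assumes "disphenoid X Y Z x u v w"
  obtains N :: point where "N \<bullet> (u - x) = a" "N \<bullet> (v - x) = b" "N \<bullet> (w - x) = c"
proof -
  note inn = disphenoid_inner[OF assms(1)]
  have pos: "X > 0" "Y > 0" "Z > 0" using assms(1) by (auto simp: disphenoid_def)
  define e f g where "e = u - x" and "f = v - x" and "g = w - x"
  note efg = e_def[symmetric] f_def[symmetric] g_def[symmetric]
  note inn = inn[unfolded efg]
  \<comment> \<open>The bimedian \<open>f + g - e\<close> is orthogonal to \<open>e\<close> and has
    product \<open>2 * X\<close> with \<open>f\<close> and with \<open>g\<close>, and similarly for
    the other two. The coefficients solve the resulting linear system.\<close>
  define N where "N = ((b + c - a) / (4 * X)) *\<^sub>R (f + g - e) + ((a + c - b) / (4 * Y)) *\<^sub>R (e + g - f)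
     + ((a + b - c) / (4 * Z)) *\<^sub>R (e + f - g)"
  have v: "(f + g - e) \<bullet> e = 0" "(f + g - e) \<bullet> f = 2 * X" "(f + g - e) \<bullet> g = 2 * X"
    "(e + g - f) \<bullet> e = 2 * Y" "(e + g - f) \<bullet> f = 0" "(e + g - f) \<bullet> g = 2 * Y"
    "(e + f - g) \<bullet> e = 2 * Z" "(e + f - g) \<bullet> f = 2 * Z" "(e + f - g) \<bullet> g = 0"
    using inn inner_commute[of f e] inner_commute[of g e] inner_commute[of g f]
    by (simp_all add: inner_diff_left inner_add_left)
  have "N \<bullet> e = a" "N \<bullet> f = b" "N \<bullet> g = c"
    unfolding N_def inner_add_left inner_scaleR_left v using pos by (auto simp: field_simps)
  then show ?thesis using that unfolding efg by blast
qed

text \<open>Equal distances make the product of \<open>d = y - x\<close> with each edge at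
  \<open>x\<close> equal to half of \<open>d \<bullet> d\<close>. This fixes the direction of
  \<open>d\<close> and leaves two lengths, of which \<open>y \<noteq> x\<close> excludes 0. The
  formula is twice the foot of the altitude from \<open>x\<close>, in barycentric coordinates, minus
  \<open>x\<close>.\<close>

lemma disphenoid_reflection:
  fixes X Y Z :: real
  defines "S \<equiv> 1 / X + 1 / Y + 1 / Z"
  assumes "disphenoid X Y Z x u v w"
    and "y \<noteq> x" "dist y u = dist x u" "dist y v = dist x v" "dist y w = dist x w"
  shows "y = - x + (2 - 4 / (S * X)) *\<^sub>R u + (2 - 4 / (S * Y)) *\<^sub>R v + (2 - 4 / (S * Z)) *\<^sub>R w"
proof -
  note inn = disphenoid_inner[OF assms(2)]
  have pos: "X > 0" "Y > 0" "Z > 0" using assms(2) by (auto simp: disphenoid_def)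
  define e f g where "e = u - x" and "f = v - x" and "g = w - x"
  note efg = e_def[symmetric] f_def[symmetric] g_def[symmetric]
  note inn = inn[unfolded efg]
  have S: "S > 0" unfolding S_def using pos by (simp add: add_pos_pos)
  define a b c where "a = 4 / (S * X)" and "b = 4 / (S * Y)" and "c = 4 / (S * Z)"
  have XYZ: "a * X = 4 / S" "b * Y = 4 / S" "c * Z = 4 / S"
    using pos S by (auto simp: a_def b_def c_def field_simps)
  have "(a + b + c) * S = 4 * S"
    using pos S unfolding a_def b_def c_def S_def
    by (simp add: divide_simps) (simp add: algebra_simps)
  then have sum: "a + b + c = 4" using S by simp
  \<comment> \<open>The candidate for \<open>y - x\<close>: its product with every edge is
    \<open>8 / S\<close>, which is half of \<open>N \<bullet> N\<close>.\<close>
  define N where "N = (2 - a) *\<^sub>R e + (2 - b) *\<^sub>R f + (2 - c) *\<^sub>R g"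
  have "(2 - a) * (Y + Z) + (2 - b) * Z + (2 - c) * Y = 8 / S"
    "(2 - a) * Z + (2 - b) * (X + Z) + (2 - c) * X = 8 / S"
    "(2 - a) * Y + (2 - b) * X + (2 - c) * (X + Y) = 8 / S"
    using XYZ sum by algebra+
  then have N: "N \<bullet> e = 8 / S" "N \<bullet> f = 8 / S" "N \<bullet> g = 8 / S"
    unfolding N_def inner_add_left inner_scaleR_left
    using inn by (simp_all add: inner_commute)
  have "N \<bullet> N = ((2 - a) + (2 - b) + (2 - c)) * (8 / S)"
    by (subst (2) N_def) (simp only: inner_add_right inner_scaleR_right N distrib_right)
  moreover have "(2 - a) + (2 - b) + (2 - c) = 2" using sum by simp
  ultimately have NN: "N \<bullet> N = 16 / S" by simp
  define d where "d = y - x"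
  have "d \<noteq> 0" using assms(3) by (simp add: d_def)
  have d: "d \<bullet> e = (d \<bullet> d) / 2" "d \<bullet> f = (d \<bullet> d) / 2" "d \<bullet> g = (d \<bullet> d) / 2"
    using assms(4-6)[THEN arg_cong[where f = "\<lambda>t. t\<^sup>2"]]
    unfolding d_def e_def f_def g_def dist_norm power2_norm_eq_inner
    by (simp_all add: inner_diff_left inner_diff_right inner_commute algebra_simps)
  \<comment> \<open>With this \<open>s\<close>, the vectors \<open>d\<close> and
    \<open>s *\<^sub>R N\<close> have the same products with all three edges. Comparing squared
    lengths then leaves \<open>s = s * s\<close>.\<close>
  define s where "s = (d \<bullet> d) * S / 16"
  have "d - s *\<^sub>R N = 0"
    using S N d unfolding e_def f_def g_def
    by (intro disphenoid_orthogonal_eq_0[OF assms(2)])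
      (simp_all add: inner_diff_left s_def)
  then have ds: "d = s *\<^sub>R N" by simp
  have "s * (16 / S) = d \<bullet> d" using S by (simp add: s_def)
  also have "d \<bullet> d = s * s * (16 / S)" by (subst (1 2) ds) (simp add: NN)
  finally have "s = s * s" using S by simp
  then have "s = 1" using ds \<open>d \<noteq> 0\<close> by auto
  then have "y = x + N" using ds by (simp add: d_def algebra_simps)
  also have "\<dots> = (1 - (2 - a) - (2 - b) - (2 - c)) *\<^sub>R x
      + (2 - a) *\<^sub>R u + (2 - b) *\<^sub>R v + (2 - c) *\<^sub>R w"
    unfolding N_def e_def f_def g_def by (simp add: vec_eq_iff algebra_simps)
  also have "1 - (2 - a) - (2 - b) - (2 - c) = -1" using sum by simp
  finally show ?thesis unfolding a_def b_def c_def by simp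
qed

section \<open>The reflection recurrence\<close>

text \<open>The coefficients come from \<open>disphenoid_reflection\<close>, with the middle weight
  \<open>4 - x - y\<close> eliminated. Passing to the next window exchanges \<open>X\<close> and
  \<open>Z\<close>, hence the dependence on parity. \<open>K\<close> is the last index of the finite
  sequence.\<close>

definition reflection_recurrence :: "real \<Rightarrow> real \<Rightarrow> nat \<Rightarrow> (nat \<Rightarrow> 'a::real_vector) \<Rightarrow> bool" where
  "reflection_recurrence x y K f \<longleftrightarrow> (\<forall>i. i + 4 \<le> K \<longrightarrow>
     f (i + 4) = - f i + (if even i then 2 - x else 2 - y) *\<^sub>R f (i + 1)
       + (x + y - 2) *\<^sub>R f (i + 2) + (if even i then 2 - y else 2 - x) *\<^sub>R f (i + 3))"

text \<open>The four coefficients sum to 1, so the recurrence is compatible with translations and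
  passes to every affine function.\<close>

lemma reflection_recurrence_functional:
  fixes z :: "nat \<Rightarrow> 'a::real_inner"
  assumes "reflection_recurrence x y K z"
  shows "reflection_recurrence x y K (\<lambda>i. N \<bullet> (z i - w))"
  unfolding reflection_recurrence_def
proof (intro allI impI)
  fix i assume "i + 4 \<le> K"
  then have e: "z (i + 4) = - z i + (if even i then 2 - x else 2 - y) *\<^sub>R z (i + 1)
       + (x + y - 2) *\<^sub>R z (i + 2) + (if even i then 2 - y else 2 - x) *\<^sub>R z (i + 3)"
    using assms by (simp add: reflection_recurrence_def)
  show "N \<bullet> (z (i + 4) - w) = - (N \<bullet> (z i - w))
       + (if even i then 2 - x else 2 - y) *\<^sub>R (N \<bullet> (z (i + 1) - w))
       + (x + y - 2) *\<^sub>R (N \<bullet> (z (i + 2) - w))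
       + (if even i then 2 - y else 2 - x) *\<^sub>R (N \<bullet> (z (i + 3) - w))"
    unfolding e by (simp add: inner_diff_right inner_add_right algebra_simps)
qed

text \<open>The cube of the screw motion in coordinates: \<open>a\<close> to \<open>f\<close> are
  six successive values, the left sides are the next four with earlier results inserted, and
  \<open>t\<close> is the gain over six steps. Everything is a polynomial identity modulo
  \<open>x * y = 1\<close>.\<close>

lemma reflection_period_identities:
  fixes x y a b c d e f :: real
  assumes xy: "x * y = 1"
    and e: "e = - a + (2 - x) * b + (x + y - 2) * c + (2 - y) * d"
    and f: "f = - b + (2 - y) * c + (x + y - 2) * d + (2 - x) * e"
  defines "t \<equiv> (4 - x - y) * (d - a) + (x\<^sup>2 - 5 * x + 5 - y) * (b - c)"
  shows "- c + (2 - x) * d + (x + y - 2) * e + (2 - y) * f = a + t"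
    and "- d + (2 - y) * e + (x + y - 2) * f + (2 - x) * (a + t) = b + t"
    and "- e + (2 - x) * f + (x + y - 2) * (a + t) + (2 - y) * (b + t) = c + t"
    and "- f + (2 - y) * (a + t) + (x + y - 2) * (b + t) + (2 - x) * (c + t) = d + t"
proof -
  \<comment> \<open>Together with \<open>xy\<close> these rules cancel \<open>x\<close> against
    \<open>y\<close> inside sorted products, so that \<open>simp\<close> normalises modulo
    \<open>x * y = 1\<close>.\<close>
  have xy': "x * (y * s) = s" "y * (x * s) = s" "y * x = 1" for s
    using xy by (simp_all flip: mult.assoc add: mult.commute[of y x])
  show "- c + (2 - x) * d + (x + y - 2) * e + (2 - y) * f = a + t"
    "- d + (2 - y) * e + (x + y - 2) * f + (2 - x) * (a + t) = b + t"
    "- e + (2 - x) * f + (x + y - 2) * (a + t) + (2 - y) * (b + t) = c + t"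
    "- f + (2 - y) * (a + t) + (x + y - 2) * (b + t) + (2 - x) * (c + t) = d + t"
    unfolding t_def f e
    by (simp_all add: algebra_simps power2_eq_square xy xy')
qed

text \<open>The recurrence has order 4, and the period 2 of its coefficients divides 6. A shift by a
  constant that holds at four successive indices therefore propagates, because the coefficients sum
  to 1.\<close>

lemma reflection_recurrence_period:
  fixes f :: "nat \<Rightarrow> real"
  assumes rec: "reflection_recurrence x y K f" and xy: "x * y = 1" and "i + 6 \<le> K"
  shows "f (i + 6) = f i + ((4 - x - y) * (f 3 - f 0) + (x\<^sup>2 - 5 * x + 5 - y) * (f 1 - f 2))"
    (is "_ = _ + ?t")
  using \<open>i + 6 \<le> K\<close>
proof (induction i rule: less_induct)
  case (less i)
  have step: "f (j + 4) = - f j + (if even j then 2 - x else 2 - y) * f (j + 1)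
       + (x + y - 2) * f (j + 2) + (if even j then 2 - y else 2 - x) * f (j + 3)"
    if "j + 4 \<le> K" for j
    using rec that by (simp add: reflection_recurrence_def)
  have f4: "f 4 = - f 0 + (2 - x) * f 1 + (x + y - 2) * f 2 + (2 - y) * f 3"
    using step[of 0] less.prems by (simp del: add_2_eq_Suc add_2_eq_Suc' One_nat_def)
  have f5: "f 5 = - f 1 + (2 - y) * f 2 + (x + y - 2) * f 3 + (2 - x) * f 4"
    using step[of 1] less.prems by (simp del: add_2_eq_Suc add_2_eq_Suc' One_nat_def)
  have f6: "f 6 = - f 2 + (2 - x) * f 3 + (x + y - 2) * f 4 + (2 - y) * f 5"
    using step[of 2] less.prems by (simp del: add_2_eq_Suc add_2_eq_Suc' One_nat_def)
  have f7: "f 7 = - f 3 + (2 - y) * f 4 + (x + y - 2) * f 5 + (2 - x) * f 6" if "7 \<le> K"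
    using step[of 3] that by simp
  have f8: "f 8 = - f 4 + (2 - x) * f 5 + (x + y - 2) * f 6 + (2 - y) * f 7" if "8 \<le> K"
    using step[of 4] that by simp
  have f9: "f 9 = - f 5 + (2 - y) * f 6 + (x + y - 2) * f 7 + (2 - x) * f 8" if "9 \<le> K"
    using step[of 5] that by simp
  note period = reflection_period_identities[OF xy f4 f5]
  have g6: "f 6 = f 0 + ?t" using f6 period(1) by simp
  have g7: "f 7 = f 1 + ?t" if "7 \<le> K" using f7[OF that] g6 period(2) by simp
  have g8: "f 8 = f 2 + ?t" if "8 \<le> K" using f8[OF that] g6 g7 that period(3) by simp
  have g9: "f 9 = f 3 + ?t" if "9 \<le> K" using f9[OF that] g6 g7 g8 that period(4) by simp
  have "i = 0 \<or> i = 1 \<or> i = 2 \<or> i = 3 \<or> (\<exists>j. i = j + 4)" by presburger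
  then consider "i = 0" | "i = 1" | "i = 2" | "i = 3" | j where "i = j + 4" by blast
  then show ?case
  proof cases
    case 5
    have [simp]: "j + 4 + 6 = j + 6 + 4" by simp
    define t where "t = ?t"
    have e: "f (j + 6 + d) = f (j + d) + t" if "d < 4" for d
      using less.IH[of "j + d"] less.prems that 5 by (simp add: ac_simps t_def)
    have "f (i + 6) = - f (j + 6) + (if even j then 2 - x else 2 - y) * f (j + 6 + 1)
       + (x + y - 2) * f (j + 6 + 2) + (if even j then 2 - y else 2 - x) * f (j + 6 + 3)"
      using step[of "j + 6"] less.prems 5 by simp
    also have "\<dots> = - f j + (if even j then 2 - x else 2 - y) * f (j + 1)
       + (x + y - 2) * f (j + 2) + (if even j then 2 - y else 2 - x) * f (j + 3) + t"
      using e[of 0] e[of 1] e[of 2] e[of 3] by (simp only: add_0_right) (simp add: algebra_simps)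
    also have "\<dots> = f i + t" using step[of j] less.prems 5 by simp
    finally show ?thesis unfolding t_def .
  qed (use g6 g7 g8 g9 less.prems in simp_all)
qed

lemma reflection_recurrence_closed_form:
  fixes f :: "nat \<Rightarrow> real"
  assumes "reflection_recurrence x y K f" "x * y = 1" "6 * m + j \<le> K"
  shows "f (6 * m + j) = f j + m * ((4 - x - y) * (f 3 - f 0) + (x\<^sup>2 - 5 * x + 5 - y) * (f 1 - f 2))"
  using assms(3)
proof (induction m)
  case (Suc m)
  then show ?case
    using reflection_recurrence_period[OF assms(1,2), of "6 * m + j"]
    by (simp add: algebra_simps)
qed simp

lemma reflection_recurrence_4_5:
  fixes f :: "nat \<Rightarrow> real"
  assumes "reflection_recurrence x y K f"
  shows "4 \<le> K \<Longrightarrow> f 4 = - f 0 + (2 - x) * f 1 + (x + y - 2) * f 2 + (2 - y) * f 3"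
    and "5 \<le> K \<Longrightarrow> f 5 = - f 1 + (2 - y) * f 2 + (x + y - 2) * f 3 + (2 - x) * f 4"
  using assms[unfolded reflection_recurrence_def, rule_format, of 0]
    assms[unfolded reflection_recurrence_def, rule_format, of 1]
  by (simp_all add: numeral_eq_Suc)

text \<open>Once the first three values vanish, the gain over six steps is
  \<open>(4 - x - y) * f 3\<close>. Its symmetry in \<open>x\<close> and \<open>y\<close> is why
  both branches climb equally fast.\<close>

lemma reflection_recurrence_height:
  fixes f :: "nat \<Rightarrow> real"
  assumes rec: "reflection_recurrence x y K f" and xy: "x * y = 1" and "6 * m + j \<le> K" "j < 6"
    and f: "f 0 = 0" "f 1 = 0" "f 2 = 0"
  shows "f (6 * m + j) = (m * (4 - x - y) + [0, 0, 0, 1, 2 - y, 3 - x - y] ! j) * f 3"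
proof -
  have 4: "f 4 = (2 - y) * f 3" if "4 \<le> K"
    using reflection_recurrence_4_5(1)[OF rec that] f by simp
  have 5: "f 5 = (3 - x - y) * f 3" if "5 \<le> K"
  proof -
    have "f 5 = (x + y - 2) * f 3 + (2 - x) * ((2 - y) * f 3)"
      using reflection_recurrence_4_5(2)[OF rec that] f 4 that by simp
    then show ?thesis using xy by algebra
  qed
  have "f j = ([0, 0, 0, 1, 2 - y, 3 - x - y] ! j) * f 3"
    using assms(3,4) f 4 5 by (auto simp: less_Suc_eq numeral_eq_Suc)
  then show ?thesis
    using reflection_recurrence_closed_form[OF rec xy assms(3)] f
    by (simp add: algebra_simps)
qed

text \<open>Only distances inside windows and a non-coincidence are recorded. Both survive a map
  that is injective and isometric on each tetrahedron, so the images under an embedding form a helix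
  again.\<close>

definition helix :: "real \<Rightarrow> real \<Rightarrow> real \<Rightarrow> nat \<Rightarrow> (nat \<Rightarrow> point) \<Rightarrow> bool" where
  "helix X Y Z K z \<longleftrightarrow> 0 < X \<and> 0 < Y \<and> 0 < Z \<and>
     (\<forall>i. i + 1 \<le> K \<longrightarrow> (dist (z i) (z (i + 1)))\<^sup>2 = (if even i then Y + Z else X + Y)) \<and>
     (\<forall>i. i + 2 \<le> K \<longrightarrow> (dist (z i) (z (i + 2)))\<^sup>2 = X + Z) \<and>
     (\<forall>i. i + 3 \<le> K \<longrightarrow> (dist (z i) (z (i + 3)))\<^sup>2 = (if even i then X + Y else Y + Z)) \<and>
     (\<forall>i. i + 4 \<le> K \<longrightarrow> z (i + 4) \<noteq> z i)"

lemma helix_dist: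
  assumes "helix X Y Z K z"
  shows "i + 1 \<le> K \<Longrightarrow> (dist (z i) (z (i + 1)))\<^sup>2 = (if even i then Y + Z else X + Y)"
    and "i + 2 \<le> K \<Longrightarrow> (dist (z i) (z (i + 2)))\<^sup>2 = X + Z"
    and "i + 3 \<le> K \<Longrightarrow> (dist (z i) (z (i + 3)))\<^sup>2 = (if even i then X + Y else Y + Z)"
  using assms by (simp_all add: helix_def)

lemma helix_disphenoid:
  assumes "helix X Y Z K z" "i + 3 \<le> K"
  shows "disphenoid (if even i then X else Z) Y (if even i then Z else X)
    (z i) (z (i + 1)) (z (i + 2)) (z (i + 3))"
proof -
  note h = helix_dist[OF assms(1)]
  have "i + 1 + 1 = i + 2" "i + 2 + 1 = i + 3" "i + 1 + 2 = i + 3" by simp_all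
  note e = this
  show ?thesis
    using assms h(1)[of i] h(1)[of "i + 1"] h(1)[of "i + 2"] h(2)[of i] h(2)[of "i + 1"] h(3)[of i]
    unfolding e by (auto simp: disphenoid_def helix_def)
qed

text \<open>The points \<open>z i\<close> and \<open>z (i + 4)\<close> have equal distances to the
  three points between them, so each is the mirror image of the other.\<close>

lemma helix_reflection_recurrence:
  fixes X Y Z :: real
  defines "S \<equiv> 1 / X + 1 / Y + 1 / Z"
  assumes "helix X Y Z K z"
  shows "reflection_recurrence (4 / (S * X)) (4 / (S * Z)) K z"
  unfolding reflection_recurrence_def
proof (intro allI impI)
  fix i assume i: "i + 4 \<le> K"
  define X' Z' where "X' = (if even i then X else Z)" and "Z' = (if even i then Z else X)"
  have pos: "X > 0" "Y > 0" "Z > 0" using assms(2) by (auto simp: helix_def)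
  have S: "S > 0" unfolding S_def using pos by (simp add: add_pos_pos)
  have "(4 / (S * X) + 4 / (S * Y) + 4 / (S * Z)) * S = 4 * S"
    using pos S unfolding S_def by (simp add: divide_simps) (simp add: algebra_simps)
  then have sum: "2 - 4 / (S * Y) = 4 / (S * X) + 4 / (S * Z) - 2" using S by simp
  have S': "S = 1 / X' + 1 / Y + 1 / Z'" by (simp add: S_def X'_def Z'_def)
  have e: "i + 1 + 1 = i + 2" "i + 2 + 1 = i + 3" "i + 1 + 2 = i + 3" "i + 3 + 1 = i + 4"
    "i + 2 + 2 = i + 4" "i + 1 + 3 = i + 4" by simp_all
  have "z (i + 4) = - z i + (2 - 4 / (S * X')) *\<^sub>R z (i + 1) + (2 - 4 / (S * Y)) *\<^sub>R z (i + 2)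
     + (2 - 4 / (S * Z')) *\<^sub>R z (i + 3)"
    unfolding S'
  proof (rule disphenoid_reflection)
    show "disphenoid X' Y Z' (z i) (z (i + 1)) (z (i + 2)) (z (i + 3))"
      using helix_disphenoid[OF assms(2), of i] i by (simp add: X'_def Z'_def)
    show "z (i + 4) \<noteq> z i" using assms(2) i by (simp add: helix_def)
    have "(dist (z i) (z (i + 1)))\<^sup>2 = (dist (z (i + 1)) (z (i + 1 + 3)))\<^sup>2"
      using helix_dist(1)[OF assms(2), of i] helix_dist(3)[OF assms(2), of "i + 1"] i by simp
    moreover have "(dist (z i) (z (i + 2)))\<^sup>2 = (dist (z (i + 2)) (z (i + 2 + 2)))\<^sup>2"
      using helix_dist(2)[OF assms(2), of i] helix_dist(2)[OF assms(2), of "i + 2"] i by simp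
    moreover have "(dist (z i) (z (i + 3)))\<^sup>2 = (dist (z (i + 3)) (z (i + 3 + 1)))\<^sup>2"
      using helix_dist(3)[OF assms(2), of i] helix_dist(1)[OF assms(2), of "i + 3"] i by simp
    ultimately show "dist (z (i + 4)) (z (i + 1)) = dist (z i) (z (i + 1))"
      "dist (z (i + 4)) (z (i + 2)) = dist (z i) (z (i + 2))"
      "dist (z (i + 4)) (z (i + 3)) = dist (z i) (z (i + 3))"
      unfolding e by (simp_all add: power2_eq_iff_nonneg dist_commute)
  qed
  then show "z (i + 4) = - z i + (if even i then 2 - 4 / (S * X) else 2 - 4 / (S * Z)) *\<^sub>R z (i + 1)
     + (4 / (S * X) + 4 / (S * Z) - 2) *\<^sub>R z (i + 2)
     + (if even i then 2 - 4 / (S * Z) else 2 - 4 / (S * X)) *\<^sub>R z (i + 3)"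
    by (simp add: sum X'_def Z'_def)
qed

section \<open>Combinatorics of the double chain\<close>

text \<open>
  Two sequences of points start in the same tetrahedron, \<open>p\<close> as \<open>p 0, p 1, p 2, p 3\<close> and \<open>q\<close> as
  \<open>p 2, p 1, p 0, p 3\<close>, and the tetrahedra are their windows of length 4.
\<close>

definition windows :: "nat \<Rightarrow> (nat \<Rightarrow> 'a) \<Rightarrow> 'a set set" where
  "windows k p = (\<lambda>m. p ` {m..m + 3}) ` {..k}"

definition double_chain :: "nat \<Rightarrow> (nat \<Rightarrow> 'a) \<Rightarrow> (nat \<Rightarrow> 'a) \<Rightarrow> bool" where
  "double_chain k p q \<longleftrightarrow> 2 \<le> k \<and> q 0 = p 2 \<and> q 1 = p 1 \<and> q 2 = p 0 \<and> q 3 = p 3 \<and>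
     inj_on p {..k + 3} \<and> inj_on q {..k + 3} \<and>
     p ` {4..k + 3} \<inter> q ` {4..k + 3} = {}"

lemma double_chain_commute: "double_chain k p q \<Longrightarrow> double_chain k q p"
  by (simp add: double_chain_def Int_commute)

lemma double_chain_image_eq:
  assumes "double_chain k p q"
  shows "p ` {0..3} = q ` {0..3}"
proof -
  have "{0..3} = {0, 1, 2, 3::nat}" by auto
  then show ?thesis using assms by (auto simp: double_chain_def)
qed

lemma double_chain_neq:
  assumes "double_chain k p q" "i \<in> {4..k + 3}" "j \<le> k + 3"
  shows "p i \<noteq> q j"
proof (cases "j \<ge> 4")
  case False
  then have "q j \<in> p ` {0..3}" using double_chain_image_eq[OF assms(1)] by force
  then obtain j' where "j' \<le> 3" "q j = p j'" by auto
  moreover have "inj_on p {..k + 3}" using assms(1) by (simp add: double_chain_def)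
  ultimately show ?thesis using assms(2) inj_onD[of p "{..k + 3}" i j'] by auto
next
  case True
  moreover have "p ` {4..k + 3} \<inter> q ` {4..k + 3} = {}" using assms(1) by (simp add: double_chain_def)
  ultimately show ?thesis using assms(2,3) by fastforce
qed

lemma double_chain_notin_window:
  assumes "double_chain k p q" "i \<in> {4..k + 3}" "S \<in> windows k q"
  shows "p i \<notin> S"
proof -
  obtain m where "m \<le> k" "S = q ` {m..m + 3}" using assms(3) by (auto simp: windows_def)
  moreover have "p i \<noteq> q j" if "j \<in> {m..m + 3}" for j
    using double_chain_neq[OF assms(1,2), of j] that \<open>m \<le> k\<close> by simp
  ultimately show ?thesis by blast
qed

text \<open>Indices that differ by 3 share only one window of \<open>p\<close>, and
  \<open>1 \<le> m\<close> makes \<open>m + 3\<close> an index that does not occur on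
  \<open>q\<close>. Faces through both ends of a window are thus never glued.\<close>

lemma window_boundary_face:
  assumes dc: "double_chain k p q" and "1 \<le> m" "m \<le> k"
    and S: "S \<in> windows k p \<union> windows k q" "p m \<in> S" "p (m + 3) \<in> S"
  shows "S = p ` {m..m + 3}"
proof -
  have inj: "inj_on p {..k + 3}" using dc by (simp add: double_chain_def)
  have "S \<notin> windows k q"
    using double_chain_notin_window[OF dc, of "m + 3"] assms by auto
  with S(1) obtain m' where m': "m' \<le> k" "S = p ` {m'..m' + 3}" by (auto simp: windows_def)
  with S(2,3) obtain i j where "i \<in> {m'..m' + 3}" "j \<in> {m'..m' + 3}" "p m = p i" "p (m + 3) = p j"
    by auto
  then have "m = i" "m + 3 = j"
    using inj_onD[OF inj, of m i] inj_onD[OF inj, of "m + 3" j] m'(1) assms(3) by auto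
  with \<open>i \<in> _\<close> \<open>j \<in> _\<close> have "m = m'" by simp
  then show ?thesis using m' by simp
qed

lemma last_window:
  assumes dc: "double_chain k p q"
    and S: "S \<in> windows k p \<union> windows k q" "p (k + 3) \<in> S"
  shows "S = p ` {k..k + 3}"
proof -
  have inj: "inj_on p {..k + 3}" using dc by (simp add: double_chain_def)
  have "4 \<le> k + 3" using dc by (simp add: double_chain_def)
  then have "S \<notin> windows k q"
    using double_chain_notin_window[OF dc, of "k + 3"] assms by auto
  with S(1) obtain m' where m': "m' \<le> k" "S = p ` {m'..m' + 3}" by (auto simp: windows_def)
  with S(2) obtain i where "i \<in> {m'..m' + 3}" "p (k + 3) = p i" by auto
  then have "k + 3 = i" using inj_onD[OF inj, of "k + 3" i] m'(1) by auto
  with \<open>i \<in> _\<close> m' have "m' = k" by simp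
  then show ?thesis using m' by simp
qed

text \<open>Among the windows of \<open>p\<close> only the first contains \<open>p 0\<close>, and
  among those of \<open>q\<close> only the first contains \<open>q 0 = p 2\<close>; these two
  windows are the same set.\<close>

lemma base_window:
  assumes dc: "double_chain k p q"
    and S: "S \<in> windows k p \<union> windows k q" "p 0 \<in> S" "p 2 \<in> S"
  shows "S = p ` {0..3}"
proof -
  have *: "S = p ` {0..3}" if S: "S \<in> windows k p" "p 0 \<in> S" and inj: "inj_on p {..k + 3}" for p S
  proof -
    from S(1) obtain m' where m': "m' \<le> k" "S = p ` {m'..m' + 3}" by (auto simp: windows_def)
    with S(2) obtain i where "i \<in> {m'..m' + 3}" "p 0 = p i" by auto
    then have "0 = i" using inj_onD[OF inj, of 0 i] m'(1) by auto
    with \<open>i \<in> _\<close> m' have "m' = 0" by simp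
    then show ?thesis using m' by simp
  qed
  show ?thesis
    using *[of S p] *[of S q] double_chain_image_eq[OF dc] S dc
    by (auto simp: double_chain_def)
qed

section \<open>Vertices, faces and degrees of the resulting sphere\<close>

definition double_chain_sphere :: "point set list \<Rightarrow> nat \<Rightarrow> (nat \<Rightarrow> point) \<Rightarrow> (nat \<Rightarrow> point) \<Rightarrow> bool" where
  "double_chain_sphere T k p q \<longleftrightarrow>
     double_chain k p q \<and> distinct T \<and> set T = windows k p \<union> windows k q"

lemma double_chain_sphere_commute:
  "double_chain_sphere T k p q \<Longrightarrow> double_chain_sphere T k q p"
  by (auto simp: double_chain_sphere_def double_chain_commute)

text \<open>The sphere counts list positions, whereas the window lemmas identify tetrahedra as
  sets.\<close>

lemma ex1_index_iff:
  assumes "distinct T"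
  shows "(\<exists>!i. i < length T \<and> P (T ! i)) \<longleftrightarrow> (\<exists>!S. S \<in> set T \<and> P S)"
proof
  assume L: "\<exists>!i. i < length T \<and> P (T ! i)"
  then obtain i where "i < length T" "P (T ! i)" by blast
  with L show "\<exists>!S. S \<in> set T \<and> P S"
    by (intro ex1I[of _ "T ! i"]) (auto simp: in_set_conv_nth)
next
  assume R: "\<exists>!S. S \<in> set T \<and> P S"
  then obtain i where "i < length T" "P (T ! i)" by (auto simp: in_set_conv_nth)
  with R show "\<exists>!i. i < length T \<and> P (T ! i)"
    by (intro ex1I[of _ i]) (auto simp: nth_eq_iff_index_eq[OF assms, symmetric])
qed

lemma faces_multi_tetrahedral_sphere:
  assumes "distinct T"
  shows "F \<in> faces (multi_tetrahedral_sphere T) \<longleftrightarrow> (\<exists>!S. S \<in> set T \<and> F \<in> tet_faces S)"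
proof -
  have "F \<in> faces (multi_tetrahedral_sphere T) \<longleftrightarrow>
      card F = 3 \<and> (\<exists>!i. i < length T \<and> F \<in> tet_faces (T ! i))"
    by (auto simp: faces_def multi_tetrahedral_sphere_def tet_edges_def)
  also have "\<dots> \<longleftrightarrow> (\<exists>!i. i < length T \<and> F \<in> tet_faces (T ! i))"
    by (auto simp: tet_faces_def)
  finally show ?thesis using ex1_index_iff[OF assms, of "\<lambda>S. F \<in> tet_faces S"] by simp
qed

lemma vertices_multi_tetrahedral_sphere: "vertices (multi_tetrahedral_sphere T) = \<Union> (set T)"
  by (auto simp: vertices_def multi_tetrahedral_sphere_def tet_edges_def tet_faces_def)

lemma edges_multi_tetrahedral_sphere:
  "edges (multi_tetrahedral_sphere T) = {e. card e = 2 \<and> (\<exists>S\<in>set T. e \<subseteq> S)}"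
  by (auto simp: edges_def multi_tetrahedral_sphere_def tet_edges_def tet_faces_def)

lemma Union_windows: "\<Union> (windows k p) = p ` {..k + 3}"
proof -
  have "\<Union> (windows k p) = p ` (\<Union>m\<in>{..k}. {m..m + 3})" by (auto simp: windows_def)
  also have "(\<Union>m\<in>{..k}. {m..m + 3}) = {..k + 3}"
  proof
    show "{..k + 3} \<subseteq> (\<Union>m\<in>{..k}. {m..m + 3})"
    proof
      fix i assume "i \<in> {..k + 3}"
      \<comment> \<open>The last window starts at \<open>k\<close>, so the start is clamped there
        for the final indices.\<close>
      then have "i \<in> {min i k..min i k + 3}" "min i k \<in> {..k}" by auto
      then show "i \<in> (\<Union>m\<in>{..k}. {m..m + 3})" by (rule UN_I[rotated])
    qed
  qed auto
  finally show ?thesis .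
qed

lemma vertices_double_chain_sphere:
  assumes "double_chain_sphere T k p q"
  shows "vertices (multi_tetrahedral_sphere T) = p ` {..k + 3} \<union> q ` {..k + 3}"
  using assms by (simp add: vertices_multi_tetrahedral_sphere double_chain_sphere_def Union_windows)

lemma boundary_face:
  assumes "double_chain_sphere T k p q" "1 \<le> m" "m \<le> k" "z \<in> {m + 1, m + 2}"
  shows "p ` {m, z, m + 3} \<in> faces (multi_tetrahedral_sphere T)"
proof -
  have dc: "double_chain k p q" using assms(1) by (simp add: double_chain_sphere_def)
  then have inj: "inj_on p {..k + 3}" by (simp add: double_chain_def)
  have "card (p ` {m, z, m + 3}) = 3"
    using assms by (subst card_image[OF inj_on_subset[OF inj]]) auto
  moreover have "{m, z, m + 3} \<subseteq> {m..m + 3}" using assms by auto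
  ultimately have "p ` {m, z, m + 3} \<in> tet_faces (p ` {m..m + 3})"
    by (auto simp: tet_faces_def)
  moreover have "S = p ` {m..m + 3}" if "S \<in> set T" "p ` {m, z, m + 3} \<in> tet_faces S" for S
    using that assms by (intro window_boundary_face[OF dc assms(2,3)])
      (auto simp: double_chain_sphere_def tet_faces_def)
  moreover have "p ` {m..m + 3} \<in> set T"
    using assms by (auto simp: double_chain_sphere_def windows_def)
  ultimately show ?thesis
    using assms(1) by (auto simp: faces_multi_tetrahedral_sphere double_chain_sphere_def)
qed

lemma last_face:
  assumes "double_chain_sphere T k p q"
  shows "F \<in> faces (multi_tetrahedral_sphere T) \<and> p (k + 3) \<in> F \<longleftrightarrow>
    F \<in> {p ` {k + 1, k + 2, k + 3}, p ` {k, k + 2, k + 3}, p ` {k, k + 1, k + 3}}"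
proof -
  have dc: "double_chain k p q" using assms(1) by (simp add: double_chain_sphere_def)
  then have inj: "inj_on p {..k + 3}" by (simp add: double_chain_def)
  have inj': "inj_on p I" if "I \<subseteq> {k..k + 3}" for I
    using inj_on_subset[OF inj, of I] that by fastforce
  have T: "p ` {k..k + 3} \<in> set T"
    using assms by (auto simp: double_chain_sphere_def windows_def)
  have S: "S = p ` {k..k + 3}" if "S \<in> set T" "F \<in> tet_faces S" "p (k + 3) \<in> F" for S
    using that assms by (intro last_window[OF dc])
      (auto simp: double_chain_sphere_def tet_faces_def)
  have "F \<in> faces (multi_tetrahedral_sphere T) \<and> p (k + 3) \<in> F \<longleftrightarrow>
     F \<in> tet_faces (p ` {k..k + 3}) \<and> p (k + 3) \<in> F"
    using S T assms by (auto simp: faces_multi_tetrahedral_sphere double_chain_sphere_def)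
  also have "\<dots> \<longleftrightarrow> (\<exists>I. F = p ` I \<and> I \<subseteq> {k..k + 3} \<and> card I = 3 \<and> k + 3 \<in> I)"
  proof
    assume F: "F \<in> tet_faces (p ` {k..k + 3}) \<and> p (k + 3) \<in> F"
    then obtain I where I: "I \<subseteq> {k..k + 3}" "F = p ` I"
      by (auto simp: tet_faces_def subset_image_iff)
    obtain i where "i \<in> I" "p (k + 3) = p i" using F I by auto
    then have "k + 3 \<in> I" using inj_onD[OF inj, of "k + 3" i] I by auto
    moreover have "card I = 3"
      using F I card_image[OF inj'[OF I(1)]] by (simp add: tet_faces_def)
    ultimately show "\<exists>I. F = p ` I \<and> I \<subseteq> {k..k + 3} \<and> card I = 3 \<and> k + 3 \<in> I"
      using I by blast
  next
    assume "\<exists>I. F = p ` I \<and> I \<subseteq> {k..k + 3} \<and> card I = 3 \<and> k + 3 \<in> I"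
    then obtain I where I: "F = p ` I" "I \<subseteq> {k..k + 3}" "card I = 3" "k + 3 \<in> I" by blast
    then have "card F = 3" using card_image[OF inj'[OF I(2)]] by simp
    then show "F \<in> tet_faces (p ` {k..k + 3}) \<and> p (k + 3) \<in> F"
      using I by (simp add: tet_faces_def image_mono)
  qed
  also have "\<dots> \<longleftrightarrow>
      (\<exists>I. F = p ` I \<and> I \<in> {{k + 1, k + 2, k + 3}, {k, k + 2, k + 3}, {k, k + 1, k + 3}})"
  proof -
    have "I \<in> {{k + 1, k + 2, k + 3}, {k, k + 2, k + 3}, {k, k + 1, k + 3}}"
      if I: "I \<subseteq> {k..k + 3}" "card I = 3" "k + 3 \<in> I" for I
    proof -
      have "card ({k..k + 3} - I) = 1"
        using I finite_subset[OF I(1)] by (subst card_Diff_subset) auto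
      then obtain x where x: "{k..k + 3} - I = {x}" by (rule card_1_singletonE)
      then have x': "x \<in> {k..k + 3} - I" by simp
      with I(3) have "x \<noteq> k + 3" by blast
      with x' have "x \<in> {k, k + 1, k + 2}" by auto
      moreover have "I = {k..k + 3} - {x}" using I(1) x by blast
      moreover have "{k..k + 3} - {k} = {k + 1, k + 2, k + 3}"
        "{k..k + 3} - {k + 1} = {k, k + 2, k + 3}" "{k..k + 3} - {k + 2} = {k, k + 1, k + 3}"
        by auto
      ultimately show ?thesis by blast
    qed
    moreover have "I \<subseteq> {k..k + 3} \<and> card I = 3 \<and> k + 3 \<in> I"
      if "I \<in> {{k + 1, k + 2, k + 3}, {k, k + 2, k + 3}, {k, k + 1, k + 3}}" for I
      using that by auto
    ultimately show ?thesis by blast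
  qed
  finally show ?thesis by blast
qed

text \<open>The branches are attached to the first tetrahedron opposite \<open>p 0\<close> and
  opposite \<open>p 2\<close>, so a face through both of these stays free.\<close>

lemma base_face:
  assumes "double_chain_sphere T k p q"
  shows "p ` {0, 1, 2} \<in> faces (multi_tetrahedral_sphere T)"
proof -
  have dc: "double_chain k p q" using assms(1) by (simp add: double_chain_sphere_def)
  then have inj: "inj_on p {..k + 3}" by (simp add: double_chain_def)
  have "card (p ` {0, 1, 2}) = 3"
    by (subst card_image[OF inj_on_subset[OF inj]]) auto
  moreover have "{0, 1, 2} \<subseteq> {0..3::nat}" by auto
  ultimately have "p ` {0, 1, 2} \<in> tet_faces (p ` {0..3})"
    unfolding tet_faces_def by blast
  moreover have "S = p ` {0..3}" if "S \<in> set T" "p ` {0, 1, 2} \<in> tet_faces S" for S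
    using that assms by (intro base_window[OF dc]) (auto simp: double_chain_sphere_def tet_faces_def)
  moreover have "p ` {0..0 + 3} \<in> set T"
    using assms unfolding double_chain_sphere_def windows_def by blast
  ultimately show ?thesis
    using assms(1) unfolding faces_multi_tetrahedral_sphere[OF assms[unfolded double_chain_sphere_def, THEN conjunct2, THEN conjunct1]]
    by auto
qed

lemma finite_faces_multi_tetrahedral_sphere:
  assumes "double_chain_sphere T k p q"
  shows "finite (faces (multi_tetrahedral_sphere T))"
proof (rule finite_subset)
  show "faces (multi_tetrahedral_sphere T) \<subseteq> Pow (\<Union> (set T))"
  proof
    fix F assume "F \<in> faces (multi_tetrahedral_sphere T)"
    then obtain S where "S \<in> set T" "F \<in> tet_faces S"
      using assms unfolding double_chain_sphere_def by (auto simp: faces_multi_tetrahedral_sphere)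
    then show "F \<in> Pow (\<Union> (set T))" unfolding tet_faces_def by blast
  qed
  show "finite (Pow (\<Union> (set T)))"
    using assms by (simp add: double_chain_sphere_def Union_windows)
qed

text \<open>Windows of \<open>p\<close> with an index \<open>\<ge> 4\<close> are not windows of \<open>q\<close>, so that no face is counted twice.\<close>

lemma degree_ge:
  assumes sph: "double_chain_sphere T k p q" and "finite A" "finite B"
    and A: "\<And>I. I \<in> A \<Longrightarrow> p ` I \<in> faces (multi_tetrahedral_sphere T) \<and> x \<in> p ` I \<and>
      I \<subseteq> {..k + 3} \<and> (\<exists>i\<in>I. 4 \<le> i)"
    and B: "\<And>I. I \<in> B \<Longrightarrow> q ` I \<in> faces (multi_tetrahedral_sphere T) \<and> x \<in> q ` I \<and>
      I \<subseteq> {..k + 3}"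
  shows "card A + card B \<le> degree (multi_tetrahedral_sphere T) x"
proof -
  have dc: "double_chain k p q" using sph by (simp add: double_chain_sphere_def)
  have "A \<subseteq> Pow {..k + 3}" "B \<subseteq> Pow {..k + 3}" using A B by blast+
  moreover have "inj_on ((`) p) (Pow {..k + 3})" "inj_on ((`) q) (Pow {..k + 3})"
    using dc by (simp_all add: double_chain_def inj_on_image_Pow)
  ultimately have "card ((`) p ` A) = card A" "card ((`) q ` B) = card B"
    by (metis card_image inj_on_subset)+
  moreover have "(`) p ` A \<inter> (`) q ` B = {}"
  proof (rule ccontr)
    assume "(`) p ` A \<inter> (`) q ` B \<noteq> {}"
    then obtain I J where I: "I \<in> A" and J: "J \<in> B" and eq: "p ` I = q ` J" by auto
    obtain i where i: "i \<in> I" "4 \<le> i" "i \<le> k + 3" using A[OF I] by blast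
    then obtain j where "j \<in> J" "p i = q j" using eq by blast
    then show False using double_chain_neq[OF dc, of i j] i B[OF J] by auto
  qed
  ultimately have "card A + card B = card ((`) p ` A \<union> (`) q ` B)"
    using assms(2,3) by (simp add: card_Un_disjoint)
  also have "\<dots> \<le> card {f \<in> faces (multi_tetrahedral_sphere T). x \<in> f}"
    using finite_faces_multi_tetrahedral_sphere[OF sph] A B by (intro card_mono) auto
  finally show ?thesis by (simp add: degree_def)
qed

lemma degree_ge_4_branch:
  assumes sph: "double_chain_sphere T k p q" and "4 \<le> j" "j \<le> k + 2"
  shows "4 \<le> degree (multi_tetrahedral_sphere T) (p j)"
proof -
  define i where "i = j - 3"
  have i: "j = i + 3" "1 \<le> i" "i \<le> k" "i + 1 \<le> k" using assms by (auto simp: i_def)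
  note bf = boundary_face[OF sph]
  have f1: "p ` {i, i + 1, i + 3} \<in> faces (multi_tetrahedral_sphere T)"
    and f2: "p ` {i, i + 2, i + 3} \<in> faces (multi_tetrahedral_sphere T)"
    and f3: "p ` {i + 1, i + 3, i + 4} \<in> faces (multi_tetrahedral_sphere T)"
    using bf[of i "i + 1"] bf[of i "i + 2"] bf[of "i + 1" "i + 3"] i by (simp_all add: numeral_eq_Suc)
  \<comment> \<open>For \<open>j = k + 2\<close> no window starts at \<open>i + 2\<close>; the end
    face of the last tetrahedron then serves as the fourth face.\<close>
  define F where "F = (if i + 2 \<le> k then {i + 2, i + 3, i + 5} else {i + 2, i + 3, i + 4})"
  have f4: "p ` F \<in> faces (multi_tetrahedral_sphere T)"
  proof (cases "i + 2 \<le> k")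
    case True
    then show ?thesis using bf[of "i + 2" "i + 3"] i by (simp add: F_def numeral_eq_Suc)
  next
    case False
    then have "k = i + 1" using i by simp
    then show ?thesis using last_face[OF sph, of "p ` F"] False by (simp add: F_def numeral_eq_Suc)
  qed
  have ne: "{i, i + 1, i + 3} \<noteq> {i, i + 2, i + 3}" "{i, i + 1, i + 3} \<noteq> {i + 1, i + 3, i + 4}"
    "{i, i + 2, i + 3} \<noteq> {i + 1, i + 3, i + 4}" "{i, i + 1, i + 3} \<noteq> F" "{i, i + 2, i + 3} \<noteq> F"
    "{i + 1, i + 3, i + 4} \<noteq> F"
    by (auto simp: F_def set_eq_subset)
  let ?A = "{{i, i + 1, i + 3}, {i, i + 2, i + 3}, {i + 1, i + 3, i + 4}, F}"
  have "card ?A + card ({} :: nat set set) \<le> degree (multi_tetrahedral_sphere T) (p j)"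
  proof (rule degree_ge[OF sph])
    fix I assume "I \<in> ?A"
    then consider "I = {i, i + 1, i + 3}" | "I = {i, i + 2, i + 3}" | "I = {i + 1, i + 3, i + 4}"
      | "I = F" by blast
    then show "p ` I \<in> faces (multi_tetrahedral_sphere T) \<and> p j \<in> p ` I \<and>
      I \<subseteq> {..k + 3} \<and> (\<exists>i\<in>I. 4 \<le> i)"
    proof cases
      case 1 then show ?thesis using f1 i by simp
    next
      case 2 then show ?thesis using f2 i by simp
    next
      case 3 then show ?thesis using f3 i by simp
    next
      case 4 then show ?thesis using f4 i by (simp add: F_def)
    qed
  qed auto
  moreover have "card ?A = 4" using ne by simp
  ultimately show ?thesis by simp
qed

lemma degree_ge_4_base:
  assumes sph: "double_chain_sphere T k p q" and "j < 4"
  shows "4 \<le> degree (multi_tetrahedral_sphere T) (p j)"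
proof -
  have k: "2 \<le> k" and pq: "q 0 = p 2" "q 1 = p 1" "q 2 = p 0" "q 3 = p 3"
    using sph by (auto simp: double_chain_sphere_def double_chain_def)
  have s: "1 + 1 = (2::nat)" "1 + 2 = (3::nat)" "1 + 3 = (4::nat)"
    "2 + 1 = (3::nat)" "2 + 2 = (4::nat)" "2 + 3 = (5::nat)" by simp_all
  note bf = boundary_face[of T k _ _ 1 2, unfolded s] boundary_face[of T k _ _ 1 3, unfolded s]
    boundary_face[of T k _ _ 2 3, unfolded s] boundary_face[of T k _ _ 2 4, unfolded s]
  have faces: "p ` {1, 2, 4} \<in> faces (multi_tetrahedral_sphere T)"
    "p ` {1, 3, 4} \<in> faces (multi_tetrahedral_sphere T)"
    "p ` {2, 3, 5} \<in> faces (multi_tetrahedral_sphere T)"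
    "p ` {2, 4, 5} \<in> faces (multi_tetrahedral_sphere T)"
    if "double_chain_sphere T k p q" for p q
    using bf[OF that] k by simp_all
  note sph' = double_chain_sphere_commute[OF sph]
  note F = faces[OF sph] faces[OF sph'] base_face[OF sph] base_face[OF sph']
  \<comment> \<open>The fourth face at \<open>p 2 = q 0\<close> is the base face, counted on the
    side of \<open>q\<close>. Exchanging the branches gives the case of
    \<open>p 0 = q 2\<close>.\<close>
  have two: "4 \<le> degree (multi_tetrahedral_sphere T) (p 2)"
    if sph: "double_chain_sphere T k p q" for p q
  proof -
    have "q 0 = p 2" using that by (auto simp: double_chain_sphere_def double_chain_def)
    then have "card {{1, 2, 4}, {2, 3, 5}, {2, 4, 5::nat}} + card {{0, 1, 2::nat}}
        \<le> degree (multi_tetrahedral_sphere T) (p 2)"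
      using faces[OF sph] base_face[OF double_chain_sphere_commute[OF sph]] k
      by (intro degree_ge[OF sph]) auto
    moreover have "card {{1, 2, 4}, {2, 3, 5}, {2, 4, 5::nat}} = 3"
      by (simp add: set_eq_subset)
    ultimately show ?thesis by simp
  qed
  consider "j = 0" | "j = 1" | "j = 2" | "j = 3" using \<open>j < 4\<close> by linarith
  then show ?thesis
  proof cases
    case 1
    then show ?thesis using two[OF sph'] pq by simp
  next
    case 2
    \<comment> \<open>The vertices \<open>p 1\<close> and \<open>p 3\<close> are shared by the
      branches under the same index, and each branch contributes two faces.\<close>
    have "card {{1, 2, 4}, {1, 3, 4::nat}} + card {{1, 2, 4}, {1, 3, 4::nat}}
        \<le> degree (multi_tetrahedral_sphere T) (p 1)"
      using F k pq by (intro degree_ge[OF sph]) auto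
    moreover have "card {{1, 2, 4}, {1, 3, 4::nat}} = 2" by (simp add: set_eq_subset)
    ultimately show ?thesis using 2 by simp
  next
    case 3
    then show ?thesis using two[OF sph] by simp
  next
    case 4
    have "card {{1, 3, 4}, {2, 3, 5::nat}} + card {{1, 3, 4}, {2, 3, 5::nat}}
        \<le> degree (multi_tetrahedral_sphere T) (p 3)"
      using F k pq by (intro degree_ge[OF sph]) (auto intro: image_eqI[of _ _ 3])
    moreover have "card {{1, 3, 4}, {2, 3, 5::nat}} = 2" by (simp add: set_eq_subset)
    ultimately show ?thesis using 4 by simp
  qed
qed

lemma degree_last:
  assumes "double_chain_sphere T k p q"
  shows "degree (multi_tetrahedral_sphere T) (p (k + 3)) = 3"
proof -
  have "inj_on p {..k + 3}"
    using assms by (simp add: double_chain_sphere_def double_chain_def)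
  then have inj: "inj_on ((`) p) (Pow {..k + 3})" by (rule inj_on_image_Pow)
  let ?A = "{{k + 1, k + 2, k + 3}, {k, k + 2, k + 3}, {k, k + 1, k + 3}}"
  have "degree (multi_tetrahedral_sphere T) (p (k + 3)) = card ((`) p ` ?A)"
    unfolding degree_def last_face[OF assms] by (rule arg_cong[of _ _ card]) auto
  also have "\<dots> = card ?A"
    by (intro card_image inj_on_subset[OF inj]) auto
  also have "\<dots> = 3"
  proof -
    have "{k + 1, k + 2, k + 3} \<noteq> {k, k + 2, k + 3}" "{k + 1, k + 2, k + 3} \<noteq> {k, k + 1, k + 3}"
      "{k, k + 2, k + 3} \<noteq> {k, k + 1, k + 3}" by (auto simp: set_eq_subset)
    then show ?thesis by simp
  qed
  finally show ?thesis .
qed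

lemma degree_3_vertices:
  assumes sph: "double_chain_sphere T k p q"
  shows "{x \<in> vertices (multi_tetrahedral_sphere T). degree (multi_tetrahedral_sphere T) x = 3}
    = {p (k + 3), q (k + 3)}"
proof -
  have *: "j = k + 3" if "j \<le> k + 3" "degree (multi_tetrahedral_sphere T) (p j) = 3"
      "double_chain_sphere T k p q" for j p q
  proof (rule ccontr)
    assume "j \<noteq> k + 3"
    then show False
      using that degree_ge_4_branch[OF that(3), of j] degree_ge_4_base[OF that(3), of j]
      by (cases "j < 4") auto
  qed
  note sph' = double_chain_sphere_commute[OF sph]
  show ?thesis
    unfolding vertices_double_chain_sphere[OF sph]
    using *[OF _ _ sph] *[OF _ _ sph'] degree_last[OF sph] degree_last[OF sph'] by auto
qed

section \<open>Heights and property (T1)\<close>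

text \<open>The gain of any functional does not depend on the index, so it cancels in differences;
  testing against all \<open>N\<close> gives equality of vectors.\<close>

lemma reflection_recurrence_translate:
  fixes z :: "nat \<Rightarrow> 'a::real_inner"
  assumes "reflection_recurrence x y K z" "x * y = 1" "6 * m + i \<le> K" "6 * m + j \<le> K"
  shows "z (6 * m + i) - z (6 * m + j) = z i - z j"
proof -
  have "N \<bullet> (z (6 * m + i) - z (6 * m + j)) = N \<bullet> (z i - z j)" for N
    using reflection_recurrence_closed_form
      [OF reflection_recurrence_functional[OF assms(1), of N 0] assms(2)] assms(3,4)
    by (simp add: inner_diff_right)
  then show ?thesis by (metis vector_eq_rdot inner_commute)
qed

text \<open>
  The height of the \<open>i\<close>-th point of a helix above the plane of the points 0, 1, 2, relative to the
  height of the point 3.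
\<close>

definition level :: "real \<Rightarrow> real \<Rightarrow> nat \<Rightarrow> real" where
  "level x y i = real (i div 6) * (4 - x - y) + [0, 0, 0, 1, 2 - y, 3 - x - y] ! (i mod 6)"

lemma helix_level:
  fixes z :: "nat \<Rightarrow> point"
  assumes "reflection_recurrence x y K z" "x * y = 1" "i \<le> K"
    and "N \<bullet> (z 1 - z 0) = 0" "N \<bullet> (z 2 - z 0) = 0"
  shows "N \<bullet> (z i - z 0) = level x y i * (N \<bullet> (z 3 - z 0))"
  using reflection_recurrence_height[OF reflection_recurrence_functional[OF assms(1), of N "z 0"]
    assms(2), of "i div 6" "i mod 6"] assms(3-5)
  by (simp add: level_def)

text \<open>Given \<open>x * y = 1\<close>, the bound \<open>2 < x + y\<close> expresses
  \<open>x \<noteq> 1\<close>, which keeps the levels 1, \<open>2 - y\<close> and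
  \<open>3 - x - y\<close> distinct. The bound 21/10 is a convenient margin that puts all residual
  levels between 0 and \<open>4 - x - y\<close>.\<close>

definition reciprocal_weights :: "real \<Rightarrow> real \<Rightarrow> bool" where
  "reciprocal_weights x y \<longleftrightarrow> 0 < x \<and> 0 < y \<and> x * y = 1 \<and> 2 < x + y \<and> x + y < 21 / 10"

lemma reciprocal_weights_commute: "reciprocal_weights x y \<Longrightarrow> reciprocal_weights y x"
  by (auto simp: reciprocal_weights_def mult.commute)

lemma level_residue_bounds:
  assumes "reciprocal_weights x y" "j < 6"
  defines "v \<equiv> [0, 0, 0, 1, 2 - y, 3 - x - y] ! j"
  shows "0 \<le> v" "v < 4 - x - y"
proof -
  have b: "0 < x" "0 < y" "x < 2" "y < 2" "x + y < 21 / 10"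
  proof -
    \<comment> \<open>The factors have the same sign, and both being positive would contradict the
      bound on \<open>x + y\<close>.\<close>
    have "(x - 2) * (y - 2) = 5 - 2 * (x + y)"
      using assms(1) by (simp add: reciprocal_weights_def algebra_simps)
    then have p: "(x - 2) * (y - 2) > 0" using assms(1) by (simp add: reciprocal_weights_def)
    show "0 < x" "0 < y" "x + y < 21 / 10" using assms(1) by (auto simp: reciprocal_weights_def)
    then show "x < 2" "y < 2" using p by (auto simp: zero_less_mult_iff)
  qed
  have "j \<in> {0, 1, 2, 3, 4, 5}" using assms(2) by auto
  then show "0 \<le> v" "v < 4 - x - y" using b by (auto simp: v_def)
qed

lemma level_residue_inj:
  assumes "reciprocal_weights x y" "i < 6" "j < 6"
    and "[0, 0, 0, 1, 2 - y, 3 - x - y] ! i = [0, 0, 0, 1, 2 - y, 3 - x - y] ! j"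
  shows "i = j \<or> (i < 3 \<and> j < 3)"
proof -
  have b: "0 < x" "0 < y" "x \<noteq> 1" "y \<noteq> 1" "x + y < 21 / 10" "2 < x + y" "y \<noteq> 2"
    using assms(1) by (auto simp: reciprocal_weights_def)
  have "i \<in> {0, 1, 2, 3, 4, 5}" "j \<in> {0, 1, 2, 3, 4, 5}" using assms(2,3) by auto
  then show ?thesis using assms(4) b by (elim insertE) (auto simp: algebra_simps)
qed

text \<open>As in division with remainder, the residual levels lie in \<open>[0, 4 - x - y)\<close>,
  so the number of the block decides.\<close>

lemma level_less_if_div_less:
  assumes "reciprocal_weights x y" "i div 6 < j div 6"
  shows "level x y i < level x y j"
proof -
  have "0 < 4 - x - y" using assms(1) by (auto simp: reciprocal_weights_def)
  moreover have "real (i div 6) + 1 \<le> real (j div 6)" using assms(2) by linarith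
  ultimately have "(real (i div 6) + 1) * (4 - x - y) \<le> real (j div 6) * (4 - x - y)"
    by (intro mult_right_mono) auto
  then show ?thesis
    using level_residue_bounds(2)[OF assms(1), of "i mod 6"]
      level_residue_bounds(1)[OF assms(1), of "j mod 6"]
    by (simp add: level_def algebra_simps)
qed

lemma level_eqD:
  assumes "reciprocal_weights x y" "level x y i = level x y j"
  shows "i div 6 = j div 6" "i = j \<or> (i mod 6 < 3 \<and> j mod 6 < 3)"
proof -
  show d: "i div 6 = j div 6"
    using level_less_if_div_less[OF assms(1), of i j] level_less_if_div_less[OF assms(1), of j i]
      assms(2) by linarith
  then have "i mod 6 = j mod 6 \<or> (i mod 6 < 3 \<and> j mod 6 < 3)"
    using assms(2) by (intro level_residue_inj[OF assms(1)]) (auto simp: level_def)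
  then show "i = j \<or> (i mod 6 < 3 \<and> j mod 6 < 3)" using d by (metis div_mult_mod_eq)
qed

text \<open>The bound \<open>6 * n + 8\<close> ends the last block after its three lowest points,
  which share one level; the next point would already be higher. This accounts for the admissible
  lengths of the chain.\<close>

lemma level_top:
  fixes i n :: nat
  assumes "reciprocal_weights x y" "i \<le> 6 * n + 8"
  shows "level x y i \<le> (real n + 1) * (4 - x - y)"
    and "level x y i = (real n + 1) * (4 - x - y) \<longleftrightarrow> 6 * n + 6 \<le> i"
proof -
  have top: "level x y (6 * n + 6) = (real n + 1) * (4 - x - y)"
    by (simp add: level_def algebra_simps)
  have "level x y i = level x y (6 * n + 6)" if "6 * n + 6 \<le> i"
  proof -
    define d where "d = i - 6 * (n + 1)"
    have d: "i = d + (n + 1) * 6" using that by (simp add: d_def)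
    then have "d < 3" using assms(2) by simp
    then have "i div 6 = n + 1" "i mod 6 = d" "d = 0 \<or> d = 1 \<or> d = 2"
      unfolding d by (simp_all only: div_mult_self1 mod_mult_self1) auto
    then show ?thesis unfolding top by (auto simp: level_def algebra_simps)
  qed
  moreover have "level x y i < level x y (6 * n + 6)" if "i < 6 * n + 6"
    using that by (intro level_less_if_div_less[OF assms(1)]) auto
  ultimately show "level x y i \<le> (real n + 1) * (4 - x - y)"
    "level x y i = (real n + 1) * (4 - x - y) \<longleftrightarrow> 6 * n + 6 \<le> i"
    unfolding top by fastforce+
qed

lemma helix_neq:
  assumes h: "helix X Y Z K z" and "i < j" "j \<le> i + 2" "j \<le> K"
  shows "z i \<noteq> z j"
proof -
  have "j = i + 1 \<or> j = i + 2" using assms(2,3) by auto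
  moreover have "X > 0" "Y > 0" "Z > 0" using h by (auto simp: helix_def)
  ultimately have "(dist (z i) (z j))\<^sup>2 > 0"
    using helix_dist(1,2)[OF h, of i] \<open>j \<le> K\<close> by (auto split: if_splits)
  then show ?thesis by auto
qed

text \<open>Levels separate all points except the first three of a block. Those have indices at most
  2 apart and hence positive distance.\<close>

lemma helix_inj_on:
  assumes h: "helix X Y Z K z" and rec: "reflection_recurrence x y K z"
    and xy: "reciprocal_weights x y" and "3 \<le> K"
  shows "inj_on z {..K}"
proof (rule inj_onI)
  fix i j assume ij: "i \<in> {..K}" "j \<in> {..K}" "z i = z j"
  have xy1: "x * y = 1" using xy by (simp add: reciprocal_weights_def)
  have "disphenoid X Y Z (z 0) (z 1) (z 2) (z 3)"
    using helix_disphenoid[OF h, of 0] \<open>3 \<le> K\<close> by (simp add: numeral_2_eq_2)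
  then obtain N where N: "N \<bullet> (z 1 - z 0) = 0" "N \<bullet> (z 2 - z 0) = 0" "N \<bullet> (z 3 - z 0) = 1"
    by (rule disphenoid_functional)
  have "level x y i = level x y j"
    using helix_level[OF rec xy1 _ N(1,2), of i] helix_level[OF rec xy1 _ N(1,2), of j] ij N(3)
    by simp
  note e = level_eqD[OF xy this]
  show "i = j"
  proof (rule ccontr)
    assume "i \<noteq> j"
    with e have "i mod 6 < 3" "j mod 6 < 3" by auto
    then have "j < i + 3" "i < j + 3"
      using e(1) div_mult_mod_eq[of i 6] div_mult_mod_eq[of j 6] by linarith+
    with \<open>i \<noteq> j\<close> ij helix_neq[OF h, of i j] helix_neq[OF h, of j i] show False
      by (cases i j rule: linorder_cases) auto
  qed
qed

section \<open>Disjointness of the two branches\<close>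

text \<open>
  The functional with values 1, 0, 0, 1/2 at the points 0, 1, 2, 3 is small on one branch and large
  on the other, so that the branches do not meet.
\<close>

lemma separation_first:
  fixes f :: "nat \<Rightarrow> real"
  assumes rec: "reflection_recurrence y x K f"
    and xy: "reciprocal_weights x y" "774 / 1000 \<le> x" "x \<le> 775 / 1000"
    and f: "f 0 = 1" "f 1 = 0" "f 2 = 0" "f 3 = 1 / 2" and "4 \<le> i" "i \<le> K"
  shows "f i < 1 / 10"
proof -
  have yx: "y * x = 1" and b: "2 < x + y" "x + y < 21 / 10"
    using xy(1) by (auto simp: reciprocal_weights_def mult.commute)
  have f4: "f 4 = - (x / 2)" if "4 \<le> K"
    using reflection_recurrence_4_5(1)[OF rec that] f by (simp add: field_simps)
  have f5: "f 5 = (y - x - 1) / 2" if "5 \<le> K"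
  proof -
    have "f 5 = (y + x - 2) / 2 + (2 - y) * (- (x / 2))"
      using reflection_recurrence_4_5(2)[OF rec that] f f4 that by simp
    also have "\<dots> = (y - x - 2 + y * x) / 2" by (simp add: field_simps)
    finally show ?thesis using yx by simp
  qed
  define m j where "m = i div 6" and "j = i mod 6"
  have i: "i = 6 * m + j" "j < 6" by (auto simp: m_def j_def)
  have fi: "f i = f j - m * ((4 - x - y) / 2)"
    using reflection_recurrence_closed_form[OF rec yx, of m j] i(1) \<open>i \<le> K\<close> f
    by (simp add: field_simps)
  show ?thesis
  proof (cases "m = 0")
    case True
    then have "i = 4 \<or> i = 5" using i \<open>4 \<le> i\<close> by auto
    then show ?thesis using f4 f5 \<open>i \<le> K\<close> xy b by auto
  next
    case False
    \<comment> \<open>Each full block lowers the value by more than 19/20, starting from at most 1,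
      so it ends below 1/20.\<close>
    then have "1 * ((4 - x - y) / 2) \<le> m * ((4 - x - y) / 2)"
      using b by (intro mult_right_mono) auto
    moreover have "f j \<le> 1"
    proof -
      have "j = 0 \<or> j = 1 \<or> j = 2 \<or> j = 3 \<or> j = 4 \<or> j = 5" using \<open>j < 6\<close> by linarith
      then show ?thesis using f f4 f5 i \<open>i \<le> K\<close> xy b by auto
    qed
    moreover have "19 / 20 < (4 - x - y) / 2" using b by simp
    moreover have "a - b < 1 / 10" if "1 * h \<le> b" "a \<le> 1" "19 / 20 < h" for a b h :: real
      using that by linarith
    ultimately show ?thesis unfolding fi by blast
  qed
qed

text \<open>The second branch starts with \<open>p 0\<close> and \<open>p 2\<close> exchanged, hence
  the values 0, 0, 1, 1/2. Here the gain over a block is positive, about 0.53, and the values in the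
  first block are nonnegative.\<close>

lemma separation_second:
  fixes f :: "nat \<Rightarrow> real"
  assumes rec: "reflection_recurrence x y K f"
    and xy: "reciprocal_weights x y" "774 / 1000 \<le> x" "x \<le> 775 / 1000"
    and f: "f 0 = 0" "f 1 = 0" "f 2 = 1" "f 3 = 1 / 2" and "4 \<le> i" "i \<le> K"
  shows "1 / 10 < f i"
proof -
  have yx: "x * y = 1" and b: "2 < x + y" "x + y < 21 / 10"
    using xy(1) by (auto simp: reciprocal_weights_def mult.commute)
  have x2: "(774 / 1000)\<^sup>2 \<le> x\<^sup>2" "x\<^sup>2 \<le> (775 / 1000)\<^sup>2"
    using xy(2,3) by (intro power_mono; simp)+
  have f4: "f 4 = x + y / 2 - 1" if "4 \<le> K"
    using reflection_recurrence_4_5(1)[OF rec that] f by (simp add: field_simps)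
  have f5: "f 5 = 7 / 2 * x + y / 2 - 3 / 2 - x\<^sup>2" if "5 \<le> K"
  proof -
    have "f 5 = 2 - y + (x + y - 2) / 2 + (2 - x) * (x + y / 2 - 1)"
      using reflection_recurrence_4_5(2)[OF rec that] f f4 that by simp
    also have "\<dots> = 7 / 2 * x + y / 2 - 1 - x\<^sup>2 - x * y / 2"
      by (simp add: field_simps power2_eq_square)
    finally show ?thesis using yx by simp
  qed
  define m j where "m = i div 6" and "j = i mod 6"
  have i: "i = 6 * m + j" "j < 6" by (auto simp: m_def j_def)
  have fi: "f i = f j + m * (9 / 2 * x + y / 2 - 3 - x\<^sup>2)"
    using reflection_recurrence_closed_form[OF rec yx, of m j] i(1) \<open>i \<le> K\<close> f
    by (simp add: field_simps)
  show ?thesis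
  proof (cases "m = 0")
    case True
    then have "i = 4 \<or> i = 5" using i \<open>4 \<le> i\<close> by auto
    then show ?thesis using f4 f5 \<open>i \<le> K\<close> xy b x2 by (auto simp: power2_eq_square)
  next
    case False
    have pos: "9 / 2 * x + y / 2 - 3 - x\<^sup>2 > 1 / 10"
      using xy b x2 by (simp add: power2_eq_square)
    then have "1 * (9 / 2 * x + y / 2 - 3 - x\<^sup>2) \<le> m * (9 / 2 * x + y / 2 - 3 - x\<^sup>2)"
      using False by (intro mult_right_mono) auto
    moreover have "f j \<ge> 0"
    proof -
      have "j = 0 \<or> j = 1 \<or> j = 2 \<or> j = 3 \<or> j = 4 \<or> j = 5" using \<open>j < 6\<close> by linarith
      then show ?thesis using f f4 f5 i \<open>i \<le> K\<close> xy b x2 by (auto simp: power2_eq_square)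
    qed
    ultimately show ?thesis unfolding fi using pos by (smt (verit) mult_1)
  qed
qed

text \<open>The coefficient along \<open>N\<close> is given explicitly because the sign of the third
  coordinate in (T1) is to be read off from heights.\<close>

lemma normal_frame:
  fixes a b N :: "real^3"
  assumes "N \<noteq> 0" "N \<bullet> a = 0" "N \<bullet> b = 0" "a \<notin> span {b}" "b \<noteq> 0"
  shows "\<exists>r s. w = r *\<^sub>R a + s *\<^sub>R b + (N \<bullet> w / (N \<bullet> N)) *\<^sub>R N"
proof -
  have ind: "independent {a, b}" using assms(4,5) by (simp add: independent_insert)
  have "N \<bullet> u = 0" if "u \<in> span {a, b}" for u
    using that
  proof (rule span_induct_alt)
    fix c x y assume "x \<in> {a, b}" "N \<bullet> y = 0"
    then show "N \<bullet> (c *\<^sub>R x + y) = 0" using assms(2,3) by (auto simp: inner_add_right)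
  qed simp
  then have N: "N \<notin> span {a, b}" using assms(1) inner_eq_zero_iff by blast
  then have "independent {N, a, b}" using ind by (rule independent_insertI)
  moreover have "card {N, a, b} = 3"
  proof -
    have "N \<notin> {a, b}" using N span_base by blast
    moreover have "a \<noteq> b" using assms(4) by (auto intro: span_base)
    ultimately show ?thesis by simp
  qed
  ultimately have "(UNIV :: (real^3) set) \<subseteq> span {N, a, b}"
    by (intro card_ge_dim_independent) (auto simp: dim_UNIV)
  then have "w \<in> span {N, a, b}" by auto
  then obtain t r s where w: "w = t *\<^sub>R N + r *\<^sub>R a + s *\<^sub>R b"
    by (auto simp: span_breakdown_eq algebra_simps)
  have "N \<bullet> w = t * (N \<bullet> N)" unfolding w using assms(2,3) by (simp add: inner_add_right)
  then have "t = N \<bullet> w / (N \<bullet> N)" using assms(1) by simp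
  with w show ?thesis by (metis add.assoc add.commute)
qed

text \<open>
  All vertices lie on one side of the plane through the two end faces. Hence the absolute value in
  condition (3) loses nothing and injectivity of the embedding suffices.
\<close>

lemma double_chain_T1:
  fixes T :: "point set list" and \<phi> :: "point \<Rightarrow> point"
  defines "M \<equiv> multi_tetrahedral_sphere T"
  assumes sph: "double_chain_sphere T (6 * n + 5) p q"
    and xy: "reciprocal_weights x y"
    and rec: "reflection_recurrence y x (6 * n + 8) (\<lambda>i. \<phi> (p i))"
      "reflection_recurrence x y (6 * n + 8) (\<lambda>i. \<phi> (q i))"
    and dis: "disphenoid X Y Z (\<phi> (p 0)) (\<phi> (p 1)) (\<phi> (p 2)) (\<phi> (p 3))"
    and inj: "inj_on \<phi> (vertices M)"
  shows "property_T1 M (p (6 * n + 8)) (q (6 * n + 8))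
    {p (6 * n + 8), p (6 * n + 6), p (6 * n + 7)} {q (6 * n + 8), q (6 * n + 6), q (6 * n + 7)} \<phi>"
proof -
  have k: "6 * n + 5 + 1 = 6 * n + 6" "6 * n + 5 + 2 = 6 * n + 7" "6 * n + 5 + 3 = 6 * n + 8" by simp_all
  have dc: "double_chain (6 * n + 5) p q" using sph by (simp add: double_chain_sphere_def)
  have q: "q 0 = p 2" "q 1 = p 1" "q 2 = p 0" "q 3 = p 3"
    using dc by (auto simp: double_chain_def)
  note sph' = double_chain_sphere_commute[OF sph]
  have V: "vertices M = p ` {..6 * n + 8} \<union> q ` {..6 * n + 8}"
    unfolding M_def vertices_double_chain_sphere[OF sph] k ..
  have xy1: "x * y = 1" "y * x = 1" and x2: "x + y < 4"
    using xy by (auto simp: reciprocal_weights_def mult.commute)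
  \<comment> \<open>\<open>N\<close> measures height above the common face of the first tetrahedron,
    scaled to 1 at \<open>p 3\<close>.\<close>
  obtain N where N: "N \<bullet> (\<phi> (p 1) - \<phi> (p 0)) = 0" "N \<bullet> (\<phi> (p 2) - \<phi> (p 0)) = 0"
      "N \<bullet> (\<phi> (p 3) - \<phi> (p 0)) = 1"
    using disphenoid_functional[OF dis] by blast
  then have "N \<noteq> 0" by auto
  define top where "top = (real n + 1) * (4 - x - y)"
  have top': "top = (real n + 1) * (4 - y - x)" by (simp add: top_def)
  define h where "h w = N \<bullet> (\<phi> w - \<phi> (p 0))" for w
  have hp: "h (p i) = level y x i" if "i \<le> 6 * n + 8" for i
    using helix_level[OF rec(1) xy1(2) that N(1,2)] N(3) by (simp add: h_def)
  have hq: "h (q i) = level x y i" if "i \<le> 6 * n + 8" for i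
  proof -
    have eq: "N \<bullet> \<phi> (p 1) = N \<bullet> \<phi> (p 0)" "N \<bullet> \<phi> (p 2) = N \<bullet> \<phi> (p 0)"
      using N(1,2) by (simp_all add: inner_diff_right)
    have "N \<bullet> (\<phi> (q 1) - \<phi> (q 0)) = 0" "N \<bullet> (\<phi> (q 2) - \<phi> (q 0)) = 0"
      "N \<bullet> (\<phi> (q 3) - \<phi> (q 0)) = 1"
      unfolding q using N(3) eq by (simp_all add: inner_diff_right)
    then have "N \<bullet> (\<phi> (q i) - \<phi> (q 0)) = level x y i"
      using helix_level[OF rec(2) xy1(1) that] by simp
    then show ?thesis unfolding h_def q using eq by (simp add: inner_diff_right)
  qed
  note yx = reciprocal_weights_commute[OF xy]
  let ?six = "{p (6 * n + 8), p (6 * n + 6), p (6 * n + 7), q (6 * n + 8), q (6 * n + 6), q (6 * n + 7)}"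
  have last: "i = 6 * n + 6 \<or> i = 6 * n + 7 \<or> i = 6 * n + 8"
    if "6 * n + 6 \<le> i" "i \<le> 6 * n + 8" for i using that by linarith
  have h_le: "h w \<le> top" if "w \<in> vertices M" for w
    using that level_top(1)[OF xy] level_top(1)[OF yx] unfolding V top_def
    by (auto simp: hp hq algebra_simps)
  have h_eq: "h w = top \<longleftrightarrow> w \<in> ?six" if w: "w \<in> vertices M" for w
  proof
    assume "h w = top"
    consider i where "i \<le> 6 * n + 8" "w = p i" | i where "i \<le> 6 * n + 8" "w = q i"
      using w unfolding V by auto
    then show "w \<in> ?six"
    proof cases
      case 1
      then have "6 * n + 6 \<le> i" using level_top(2)[OF yx, of i n] hp[of i] \<open>h w = top\<close> top' by simp
      then show ?thesis using 1 last[of i] by auto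
    next
      case 2
      then have "6 * n + 6 \<le> i" using level_top(2)[OF xy, of i n] hq[of i] \<open>h w = top\<close> top_def by simp
      then show ?thesis using 2 last[of i] by auto
    qed
  next
    have "h (p i) = top" if "6 * n + 6 \<le> i" "i \<le> 6 * n + 8" for i
      using level_top(2)[OF yx, of i n] hp[of i] that top' by simp
    moreover have "h (q i) = top" if "6 * n + 6 \<le> i" "i \<le> 6 * n + 8" for i
      using level_top(2)[OF xy, of i n] hq[of i] that top_def by simp
    moreover assume "w \<in> ?six"
    ultimately show "h w = top" by auto
  qed
  define v a b where "v = \<phi> (p (6 * n + 8))" and "a = \<phi> (p (6 * n + 6)) - v"
    and "b = \<phi> (p (6 * n + 7)) - v"
  \<comment> \<open>The last three points are translates of \<open>p 0\<close>, \<open>p 1\<close>,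
    \<open>p 2\<close>, so the end face is parallel to the common face.\<close>
  have ab: "a = \<phi> (p 0) - \<phi> (p 2)" "b = \<phi> (p 1) - \<phi> (p 2)"
    using reflection_recurrence_translate[OF rec(1) xy1(2), of "n + 1" 0 2]
      reflection_recurrence_translate[OF rec(1) xy1(2), of "n + 1" 1 2]
    by (simp_all add: a_def b_def v_def algebra_simps)
  have Nab: "N \<bullet> a = 0" "N \<bullet> b = 0"
    using N(1,2) unfolding ab by (simp_all add: inner_diff_right)
  \<comment> \<open>\<open>L\<close> vanishes on \<open>b\<close> but not on \<open>a\<close>, and
    \<open>L'\<close> is nonzero on \<open>b\<close>: together they show that \<open>a\<close> and
    \<open>b\<close> are independent.\<close>
  obtain L where L: "L \<bullet> (\<phi> (p 1) - \<phi> (p 0)) = 1" "L \<bullet> (\<phi> (p 2) - \<phi> (p 0)) = 1"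
    using disphenoid_functional[OF dis] by blast
  obtain L' where L': "L' \<bullet> (\<phi> (p 1) - \<phi> (p 0)) = 1" "L' \<bullet> (\<phi> (p 2) - \<phi> (p 0)) = 0"
    using disphenoid_functional[OF dis] by blast
  have "L \<bullet> a = -1" "L \<bullet> b = 0" "L' \<bullet> b = 1"
    using L L' unfolding ab by (simp_all add: inner_diff_right)
  then have "b \<noteq> 0" "a \<notin> span {b}" by (auto simp: span_singleton)
  then have "\<exists>r s. \<phi> w - v = r *\<^sub>R a + s *\<^sub>R b + (N \<bullet> (\<phi> w - v) / (N \<bullet> N)) *\<^sub>R N" for w
    using normal_frame[OF \<open>N \<noteq> 0\<close> Nab] by blast
  then obtain r s where rs: "\<phi> w - v = r w *\<^sub>R a + s w *\<^sub>R b + (N \<bullet> (\<phi> w - v) / (N \<bullet> N)) *\<^sub>R N" for w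
    by metis
  define t where "t w = N \<bullet> (\<phi> w - v) / (N \<bullet> N)" for w
  have frame: "\<phi> w = v + r w *\<^sub>R a + s w *\<^sub>R b + t w *\<^sub>R N" for w
    using rs[of w] unfolding t_def by (simp add: algebra_simps)
  have vV: "p (6 * n + 8) \<in> vertices M" unfolding V by simp
  have t: "t w = (h w - top) / (N \<bullet> N)" for w
    using h_eq[OF vV] unfolding t_def h_def v_def by (simp add: inner_diff_right)
  have NN: "N \<bullet> N > 0" using \<open>N \<noteq> 0\<close> by simp
  have t_le: "t w \<le> 0" if "w \<in> vertices M" for w
    unfolding t using h_le[OF that] NN by (simp add: divide_le_0_iff)
  have t_eq: "t w = 0 \<longleftrightarrow> w \<in> ?six" if "w \<in> vertices M" for w
    unfolding t using h_eq[OF that] NN by simp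
  define P where "P = (+) v ` span {a, b}"
  have in_P: "\<phi> w \<in> P \<longleftrightarrow> t w = 0" for w
  proof
    assume "\<phi> w \<in> P"
    then obtain u where u: "u \<in> span {a, b}" "\<phi> w = v + u" by (auto simp: P_def)
    have "N \<bullet> u = 0" using u(1)
    proof (rule span_induct_alt)
      fix c x y assume "x \<in> {a, b}" "N \<bullet> y = 0"
      then show "N \<bullet> (c *\<^sub>R x + y) = 0" using Nab by (auto simp: inner_add_right)
    qed simp
    then show "t w = 0" using u(2) by (simp add: t_def)
  next
    assume "t w = 0"
    then have "\<phi> w = v + (r w *\<^sub>R a + s w *\<^sub>R b)" using frame[of w] by simp
    moreover have "r w *\<^sub>R a + s w *\<^sub>R b \<in> span {a, b}"
      by (intro span_add span_scale span_base) auto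
    ultimately show "\<phi> w \<in> P" unfolding P_def by blast
  qed
  have six_V: "?six \<subseteq> vertices M" unfolding V by auto
  have six: "{w \<in> vertices M. \<phi> w \<in> P} = {p (6 * n + 8), p (6 * n + 6), p (6 * n + 7),
      q (6 * n + 8), q (6 * n + 6), q (6 * n + 7)}"
  proof -
    have "w \<in> vertices M \<and> \<phi> w \<in> P \<longleftrightarrow> w \<in> vertices M \<and> w \<in> ?six" for w
      unfolding in_P using t_eq[of w] by argo
    then have "{w \<in> vertices M. \<phi> w \<in> P} = vertices M \<inter> ?six"
      by (simp only: Int_def)
    then show ?thesis using six_V by (simp only: Int_absorb1)
  qed
  have edges: "e \<subseteq> {p (6 * n + 8), p (6 * n + 6), p (6 * n + 7)} \<or>
      e \<subseteq> {q (6 * n + 8), q (6 * n + 6), q (6 * n + 7)}"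
    if e: "e \<in> edges M" "convex hull (\<phi> ` e) \<subseteq> P" for e
  proof -
    obtain S where S: "S \<in> set T" "e \<subseteq> S" using e(1) by (auto simp: M_def edges_multi_tetrahedral_sphere)
    then have "e \<subseteq> vertices M" by (auto simp: M_def vertices_multi_tetrahedral_sphere)
    moreover have "\<phi> ` e \<subseteq> P" using hull_subset e(2) by (rule order_trans)
    ultimately have "e \<subseteq> {w \<in> vertices M. \<phi> w \<in> P}" by blast
    then have e6: "e \<subseteq> ?six" unfolding six .
    \<comment> \<open>An edge lies in a window of one branch, where the end points of the other
      branch do not occur. Hence no edge joins the two end faces.\<close>
    have *: "p i \<notin> S" if "S \<in> windows (6 * n + 5) q" "6 * n + 6 \<le> i" "i \<le> 6 * n + 8"
        "double_chain (6 * n + 5) p q" for i p q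
      using double_chain_notin_window[OF that(4) _ that(1), of i] that(2,3) by simp
    from S(1) sph consider "S \<in> windows (6 * n + 5) p" | "S \<in> windows (6 * n + 5) q"
      by (auto simp: double_chain_sphere_def)
    then show ?thesis
    proof cases
      case 1
      note ** = *[OF 1 _ _ double_chain_commute[OF dc]]
      have "q (6 * n + 8) \<notin> e" "q (6 * n + 6) \<notin> e" "q (6 * n + 7) \<notin> e"
        using **[of "6 * n + 8"] **[of "6 * n + 6"] **[of "6 * n + 7"] S(2) by auto
      then show ?thesis using e6 by blast
    next
      case 2
      note ** = *[OF 2 _ _ dc]
      have "p (6 * n + 8) \<notin> e" "p (6 * n + 6) \<notin> e" "p (6 * n + 7) \<notin> e"
        using **[of "6 * n + 8"] **[of "6 * n + 6"] **[of "6 * n + 7"] S(2) by auto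
      then show ?thesis using e6 by blast
    qed
  qed
  have "inj_on (\<lambda>w. (r w, s w, \<bar>t w\<bar>)) (vertices M)"
  proof (rule inj_onI)
    fix u w assume uw: "u \<in> vertices M" "w \<in> vertices M" "(r u, s u, \<bar>t u\<bar>) = (r w, s w, \<bar>t w\<bar>)"
    then have "t u = t w" using t_le[of u] t_le[of w] by simp
    then have "\<phi> u = \<phi> w" using uw(3) frame[of u] frame[of w] by simp
    then show "u = w" using inj uw(1,2) by (auto dest: inj_onD)
  qed
  then have card: "card ((\<lambda>w. (r w, s w, \<bar>t w\<bar>)) ` vertices M) = card (vertices M)"
    by (rule card_image)
  have deg: "{w \<in> vertices M. degree M w = 3} = {p (6 * n + 8), q (6 * n + 8)}"
    using degree_3_vertices[OF sph] unfolding M_def k .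
  have fv: "{p (6 * n + 8), p (6 * n + 6), p (6 * n + 7)} \<in> faces M"
    "{q (6 * n + 8), q (6 * n + 6), q (6 * n + 7)} \<in> faces M"
    using last_face[OF sph, of "{p (6 * n + 8), p (6 * n + 6), p (6 * n + 7)}"]
      last_face[OF sph', of "{q (6 * n + 8), q (6 * n + 6), q (6 * n + 7)}"]
    unfolding M_def k by (simp_all add: insert_commute)
  have neq: "p (6 * n + 8) \<noteq> q (6 * n + 8)"
    using double_chain_neq[OF dc, of "6 * n + 8" "6 * n + 8"] by simp
  note frame = frame[unfolded a_def b_def v_def]
  have frame: "\<forall>w\<in>vertices M. \<phi> w = \<phi> (p (6 * n + 8))
      + r w *\<^sub>R (\<phi> (p (6 * n + 6)) - \<phi> (p (6 * n + 8)))
      + s w *\<^sub>R (\<phi> (p (6 * n + 7)) - \<phi> (p (6 * n + 8))) + t w *\<^sub>R N"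
    using frame by blast
  have orth: "orthogonal N (\<phi> (p (6 * n + 6)) - \<phi> (p (6 * n + 8)))"
    "orthogonal N (\<phi> (p (6 * n + 7)) - \<phi> (p (6 * n + 8)))"
    using Nab unfolding a_def b_def v_def by (simp_all add: orthogonal_def)
  show ?thesis
    unfolding property_T1_def
  proof (intro conjI, fact neq, fact deg, fact fv, simp, fact fv, simp,
      rule exI[of _ "p (6 * n + 6)"], rule exI[of _ "p (6 * n + 7)"],
      rule exI[of _ "q (6 * n + 6)"], rule exI[of _ "q (6 * n + 7)"],
      rule exI[of _ N], rule exI[of _ r], rule exI[of _ s], rule exI[of _ t], rule exI[of _ P],
      intro conjI, rule refl, rule refl, fact \<open>N \<noteq> 0\<close>, fact orth, fact orth, fact frame)
    show "P = (+) (\<phi> (p (6 * n + 8))) `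
        span {\<phi> (p (6 * n + 6)) - \<phi> (p (6 * n + 8)), \<phi> (p (6 * n + 7)) - \<phi> (p (6 * n + 8))}"
      by (simp only: P_def a_def b_def v_def)
    show "\<forall>e\<in>edges M. convex hull \<phi> ` e \<subseteq> P \<longrightarrow>
        e \<subseteq> {p (6 * n + 8), p (6 * n + 6), p (6 * n + 7)} \<or>
        e \<subseteq> {q (6 * n + 8), q (6 * n + 6), q (6 * n + 7)}"
      by (intro ballI impI edges)
  qed (fact six, fact card)
qed

section \<open>Transfer along a strong embedding\<close>

lemma helix_isometric_image:
  assumes h: "helix X Y Z (k + 3) z"
    and iso: "\<And>S u w. S \<in> windows k z \<Longrightarrow> u \<in> S \<Longrightarrow> w \<in> S \<Longrightarrow> dist (\<phi> u) (\<phi> w) = dist u w"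
    and inj: "inj_on \<phi> (z ` {..k + 3})"
  shows "helix X Y Z (k + 3) (\<lambda>i. \<phi> (z i))"
proof -
  have d: "dist (\<phi> (z i)) (\<phi> (z j)) = dist (z i) (z j)" if "i \<le> j" "j \<le> i + 3" "j \<le> k + 3" for i j
  proof (rule iso)
    show "z ` {min i k..min i k + 3} \<in> windows k z" by (simp add: windows_def)
    show "z i \<in> z ` {min i k..min i k + 3}" "z j \<in> z ` {min i k..min i k + 3}"
      using that by (intro imageI; simp add: min_def)+
  qed
  have "\<phi> (z (i + 4)) \<noteq> \<phi> (z i)" if "i + 4 \<le> k + 3" for i
  proof
    assume "\<phi> (z (i + 4)) = \<phi> (z i)"
    then have "z (i + 4) = z i" by (rule inj_onD[OF inj]) (use that in auto)
    then show False using h that by (simp add: helix_def)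
  qed
  then show ?thesis using h by (simp add: helix_def d)
qed

text \<open>The non-shared points of the branches lie on different sides of the level 1/10 of one
  functional. Within a branch, levels and edge lengths give injectivity.\<close>

lemma double_chain_of_helices:
  fixes A B C :: real
  defines "S \<equiv> 1 / A + 1 / B + 1 / C"
  defines "x \<equiv> 4 / (S * A)" and "y \<equiv> 4 / (S * C)"
  assumes p: "helix C B A (k + 3) p" and q: "helix A B C (k + 3) q" and "2 \<le> k"
    and pq: "q 0 = p 2" "q 1 = p 1" "q 2 = p 0" "q 3 = p 3"
    and xy: "reciprocal_weights x y" "774 / 1000 \<le> x" "x \<le> 775 / 1000"
  shows "double_chain k p q"
proof -
  have S': "S = 1 / C + 1 / B + 1 / A" by (simp add: S_def)
  have recp: "reflection_recurrence y x (k + 3) p"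
    using helix_reflection_recurrence[OF p] unfolding x_def y_def S' .
  have recq: "reflection_recurrence x y (k + 3) q"
    using helix_reflection_recurrence[OF q] unfolding x_def y_def S_def .
  have "disphenoid C B A (p 0) (p 1) (p 2) (p 3)"
    using helix_disphenoid[OF p, of 0] by (simp add: numeral_2_eq_2)
  \<comment> \<open>Measured from \<open>p 1\<close> instead of \<open>p 0\<close>, these values
    become 1, 0, 0, 1/2, as the separation lemmas require.\<close>
  then obtain N where N: "N \<bullet> (p 1 - p 0) = -1" "N \<bullet> (p 2 - p 0) = -1" "N \<bullet> (p 3 - p 0) = - 1 / 2"
    by (rule disphenoid_functional)
  note N' = N[unfolded inner_diff_right]
  have "N \<bullet> (p i - p 1) < 1 / 10" if "4 \<le> i" "i \<le> k + 3" for i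
    by (rule separation_first[OF reflection_recurrence_functional[OF recp] xy])
      (use N' that in \<open>simp_all add: inner_diff_right\<close>)
  moreover have "1 / 10 < N \<bullet> (q i - p 1)" if "4 \<le> i" "i \<le> k + 3" for i
    by (rule separation_second[OF reflection_recurrence_functional[OF recq] xy])
      (use N' that in \<open>simp_all add: inner_diff_right pq[unfolded One_nat_def]\<close>)
  ultimately have "p i \<noteq> q j" if "4 \<le> i" "i \<le> k + 3" "4 \<le> j" "j \<le> k + 3" for i j
    using that by force
  then have "p ` {4..k + 3} \<inter> q ` {4..k + 3} = {}" by auto
  moreover have "inj_on p {..k + 3}"
    using helix_inj_on[OF p recp reciprocal_weights_commute[OF xy(1)]] by simp
  moreover have "inj_on q {..k + 3}"
    using helix_inj_on[OF q recq xy(1)] by simp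
  ultimately show ?thesis using pq \<open>2 \<le> k\<close> by (simp add: double_chain_def)
qed

text \<open>The recurrence is used twice: for the original points it yields the combinatorics of the
  sphere, for their images the geometry in (T1).\<close>

lemma helices_T1:
  fixes A B C :: real and T :: "point set list" and \<phi> :: "point \<Rightarrow> point"
  defines "S \<equiv> 1 / A + 1 / B + 1 / C"
  defines "x \<equiv> 4 / (S * A)" and "y \<equiv> 4 / (S * C)"
  assumes T: "distinct T" "set T = windows (6 * n + 5) p \<union> windows (6 * n + 5) q"
    and p: "helix C B A (6 * n + 5 + 3) p" and q: "helix A B C (6 * n + 5 + 3) q"
    and pq: "q 0 = p 2" "q 1 = p 1" "q 2 = p 0" "q 3 = p 3"
    and xy: "reciprocal_weights x y" "774 / 1000 \<le> x" "x \<le> 775 / 1000"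
    and iso: "\<And>S u w. S \<in> set T \<Longrightarrow> u \<in> S \<Longrightarrow> w \<in> S \<Longrightarrow> dist (\<phi> u) (\<phi> w) = dist u w"
    and inj: "inj_on \<phi> (vertices (multi_tetrahedral_sphere T))"
  shows "\<exists>v w fv fw. property_T1 (multi_tetrahedral_sphere T) v w fv fw \<phi>"
proof -
  have dc: "double_chain (6 * n + 5) p q"
    using double_chain_of_helices[OF p q _ pq] xy unfolding x_def y_def S_def by simp
  then have sph: "double_chain_sphere T (6 * n + 5) p q"
    using T by (simp add: double_chain_sphere_def)
  note V = vertices_double_chain_sphere[OF sph]
  have p': "helix C B A (6 * n + 5 + 3) (\<lambda>i. \<phi> (p i))"
    using T by (intro helix_isometric_image[OF p] iso inj_on_subset[OF inj]) (auto simp: V)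
  have q': "helix A B C (6 * n + 5 + 3) (\<lambda>i. \<phi> (q i))"
    using T by (intro helix_isometric_image[OF q] iso inj_on_subset[OF inj]) (auto simp: V)
  have k: "6 * n + 5 + 3 = 6 * n + 8" by simp
  have S': "S = 1 / C + 1 / B + 1 / A" by (simp add: S_def)
  have "reflection_recurrence y x (6 * n + 8) (\<lambda>i. \<phi> (p i))"
    using helix_reflection_recurrence[OF p'] unfolding x_def y_def S' k .
  moreover have "reflection_recurrence x y (6 * n + 8) (\<lambda>i. \<phi> (q i))"
    using helix_reflection_recurrence[OF q'] unfolding x_def y_def S_def k .
  moreover have "disphenoid C B A (\<phi> (p 0)) (\<phi> (p 1)) (\<phi> (p 2)) (\<phi> (p 3))"
    using helix_disphenoid[OF p', of 0] by (simp add: numeral_2_eq_2)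
  ultimately show ?thesis
    using double_chain_T1[OF sph xy(1) _ _ _ inj] by blast
qed

lemma dist_reflect_in:
  assumes "z \<in> S"
  shows "dist (reflect_in (affine hull S) x) z = dist x z"
proof -
  define H where "H = affine hull S"
  define c where "c = closest_point H x"
  have H: "convex H" "closed H" "affine H" "z \<in> H"
    using assms by (auto simp: H_def affine_imp_convex hull_inc)
  then have c: "c \<in> H" unfolding c_def by (intro closest_point_in_set) auto
  \<comment> \<open>The plane also contains the mirror image of \<open>z\<close> in
    \<open>c\<close>. The variational inequality at both points becomes orthogonality of
    \<open>x - c\<close> and \<open>z - c\<close>.\<close>
  have "(2 *\<^sub>R c + (-1) *\<^sub>R z) \<in> H" using mem_affine[OF H(3) c H(4), of 2 "-1"] by simp
  from closest_point_dot[OF H(1,2) this, of x] closest_point_dot[OF H(1,2,4), of x]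
  have "(x - c) \<bullet> (2 *\<^sub>R c + (-1) *\<^sub>R z - c) \<le> 0" "(x - c) \<bullet> (z - c) \<le> 0"
    by (simp_all add: c_def)
  then have "(x - c) \<bullet> (z - c) = 0" by (simp add: inner_diff_right)
  then have "(dist (2 *\<^sub>R c - x) z)\<^sup>2 = (dist x z)\<^sup>2"
    unfolding dist_norm power2_norm_eq_inner
    by (simp add: inner_diff_left inner_diff_right inner_commute algebra_simps)
  then show ?thesis unfolding reflect_in_def c_def H_def by (simp add: power2_eq_iff_nonneg)
qed

lemma triangle_with_sides_opposite:
  assumes "triangle_with_sides (a, b, c) {u, v, w}" "u \<noteq> v" "u \<noteq> w" "v \<noteq> w"
    and "a \<noteq> b" "b \<noteq> c" "dist u v = b"
  shows "(dist u w = a \<and> dist v w = c) \<or> (dist u w = c \<and> dist v w = a)"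
proof -
  obtain x y z where xyz: "{u, v, w} = {x, y, z}" "dist y z = a" "dist x z = b" "dist x y = c"
    using assms(1) by (auto simp: triangle_with_sides_def)
  have "x \<in> {u, v, w}" "y \<in> {u, v, w}" "z \<in> {u, v, w}" using xyz(1) by auto
  moreover have "x \<noteq> y" "x \<noteq> z" "y \<noteq> z"
  proof -
    have "card {x, y, z} = 3" using assms(2-4) by (simp flip: xyz(1))
    then show "x \<noteq> y" "x \<noteq> z" "y \<noteq> z" by (auto simp: card_insert_if split: if_splits)
  qed
  ultimately consider "x = u" "y = v" "z = w" | "x = u" "y = w" "z = v" | "x = v" "y = u" "z = w"
    | "x = v" "y = w" "z = u" | "x = w" "y = u" "z = v" | "x = w" "y = v" "z = u"
    by blast
  then show ?thesis
    using assms(5-7) xyz(2-4) by cases (auto simp: dist_commute)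
qed

section \<open>The branches of a double tetra-helix\<close>

text \<open>The vertex replaced at step \<open>m\<close> is the only one of colour
  \<open>\<sigma> m\<close>, namely \<open>p m\<close>, and its substitute becomes
  \<open>p (m + 4)\<close>. Periodicity of the colours turns the successive replacements into
  windows of a single sequence.\<close>

lemma branch_exists:
  fixes E :: "nat \<Rightarrow> 'a set" and c :: "'a \<Rightarrow> nat"
  assumes inj: "\<And>m. m \<le> k \<Longrightarrow> inj_on c (E m)"
    and base: "E 0 = b ` {0..3}" "\<And>j. j \<le> 3 \<Longrightarrow> c (b j) = \<sigma> j"
    and step: "\<And>m. m < k \<Longrightarrow> \<exists>x\<in>E m. \<exists>y. c x = \<sigma> m \<and> c y = \<sigma> m \<and> E (m + 1) = insert y (E m - {x})"
    and neq: "\<And>m. m < k \<Longrightarrow> E (m + 1) \<noteq> E m"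
    and \<sigma>: "\<And>m. \<sigma> (m + 4) = \<sigma> m" "\<And>m d. d \<in> {1, 2, 3} \<Longrightarrow> \<sigma> (m + d) \<noteq> \<sigma> m"
  obtains p where "\<And>j. j \<le> 3 \<Longrightarrow> p j = b j" "\<And>m. m \<le> k \<Longrightarrow> E m = p ` {m..m + 3}"
    "\<And>j. j \<le> k + 3 \<Longrightarrow> c (p j) = \<sigma> j" "\<And>j. j + 4 \<le> k + 3 \<Longrightarrow> p (j + 4) \<noteq> p j"
proof -
  have "\<exists>p. (\<forall>j\<le>3. p j = b j) \<and> (\<forall>m\<le>k. E m = p ` {m..m + 3}) \<and> (\<forall>j\<le>k + 3. c (p j) = \<sigma> j) \<and>
      (\<forall>j. j + 4 \<le> k + 3 \<longrightarrow> p (j + 4) \<noteq> p j)"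
    using inj step neq
  proof (induction k)
    case 0
    show ?case using base by (intro exI[of _ b]) simp
  next
    case (Suc k)
    then obtain p where p: "\<And>j. j \<le> 3 \<Longrightarrow> p j = b j" "\<And>m. m \<le> k \<Longrightarrow> E m = p ` {m..m + 3}"
      "\<And>j. j \<le> k + 3 \<Longrightarrow> c (p j) = \<sigma> j" "\<And>j. j + 4 \<le> k + 3 \<Longrightarrow> p (j + 4) \<noteq> p j"
      by (metis le_SucI less_SucI)
    obtain x y where xy: "x \<in> E k" "c x = \<sigma> k" "c y = \<sigma> k" "E (k + 1) = insert y (E k - {x})"
      using Suc.prems(2)[of k] by blast
    have "p k \<in> E k" "c (p k) = \<sigma> k" using p(2)[of k] p(3)[of k] by auto
    then have x: "x = p k" using inj_onD[OF Suc.prems(1)[of k], of x "p k"] xy(1,2) by simp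
    have "p k \<notin> p ` {k + 1..k + 3}"
    proof
      assume "p k \<in> p ` {k + 1..k + 3}"
      then obtain j where j: "j \<in> {k + 1..k + 3}" "p k = p j" by blast
      define d where "d = j - k"
      have "j = k + d" "d \<in> {1, 2, 3}" using j(1) by (auto simp: d_def)
      then show False using \<sigma>(2)[of d k] p(3)[of k] p(3)[of j] j by auto
    qed
    moreover have "{k..k + 3} = insert k {k + 1..k + 3}" by auto
    ultimately have "E k - {x} = p ` {k + 1..k + 3}" using p(2)[of k] x by auto
    define p' where "p' = p(k + 4 := y)"
    have "E (k + 1) = p' ` {k + 1..k + 4}"
    proof -
      have "{k + 1..k + 4} = insert (k + 4) {k + 1..k + 3}" by auto
      then have "p' ` {k + 1..k + 4} = insert (p' (k + 4)) (p' ` {k + 1..k + 3})"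
        by (simp only: image_insert)
      also have "p' ` {k + 1..k + 3} = p ` {k + 1..k + 3}"
        by (rule image_cong) (auto simp: p'_def)
      finally show ?thesis using xy(4) \<open>E k - {x} = _\<close> unfolding p'_def by simp
    qed
    moreover have "E m = p' ` {m..m + 3}" if "m \<le> k" for m
      unfolding p(2)[OF that] using that by (intro image_cong) (auto simp: p'_def)
    ultimately have "E m = p' ` {m..m + 3}" if "m \<le> Suc k" for m
      using that by (cases "m = Suc k") (simp_all add: add.commute[of _ k] numeral_eq_Suc)
    moreover have "y \<noteq> x" using xy Suc.prems(3)[of k] by auto
    then have "p' (j + 4) \<noteq> p' j" if "j + 4 \<le> Suc k + 3" for j
      using p(4)[of j] that x by (cases "j = k") (auto simp: p'_def)
    moreover have "c (p' j) = \<sigma> j" if "j \<le> Suc k + 3" for j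
      using p(3)[of j] that xy(3) \<sigma>(1)[of k] by (cases "j = k + 4") (auto simp: p'_def)
    moreover have "p' j = b j" if "j \<le> 3" for j using p(1)[OF that] that by (simp add: p'_def)
    ultimately show ?case by blast
  qed
  then show ?thesis using that by blast
qed

lemma helix_of_branch:
  assumes pos: "0 < X" "0 < Y" "0 < Z"
    and p: "\<And>m. m \<le> k \<Longrightarrow> E m = p ` {m..m + 3}" "\<And>j. j \<le> k + 3 \<Longrightarrow> c (p j) = \<sigma> j"
      "\<And>j. j + 4 \<le> k + 3 \<Longrightarrow> p (j + 4) \<noteq> p j"
    and D: "\<And>m u w. m \<le> k \<Longrightarrow> u \<in> E m \<Longrightarrow> w \<in> E m \<Longrightarrow> u \<noteq> w \<Longrightarrow> (dist u w)\<^sup>2 = D {c u, c w}"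
    and \<sigma>: "\<And>m d. d \<in> {1, 2, 3} \<Longrightarrow> \<sigma> (m + d) \<noteq> \<sigma> m"
      "\<And>m. D {\<sigma> m, \<sigma> (m + 1)} = (if even m then Y + Z else X + Y)"
      "\<And>m. D {\<sigma> m, \<sigma> (m + 2)} = X + Z"
      "\<And>m. D {\<sigma> m, \<sigma> (m + 3)} = (if even m then X + Y else Y + Z)"
  shows "helix X Y Z (k + 3) p"
proof -
  have "(dist (p i) (p (i + d)))\<^sup>2 = D {\<sigma> i, \<sigma> (i + d)}" if "d \<in> {1, 2, 3}" "i + d \<le> k + 3" for i d
  proof -
    have c: "c (p i) = \<sigma> i" "c (p (i + d)) = \<sigma> (i + d)" using p(2) that by auto
    then have "p i \<noteq> p (i + d)" using \<sigma>(1)[OF that(1), of i] by metis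
    moreover have "p i \<in> E (min i k)" "p (i + d) \<in> E (min i k)"
      unfolding p(1)[OF min.cobounded2] using that by (intro imageI; auto simp: min_def)+
    ultimately show ?thesis using D[of "min i k" "p i" "p (i + d)"] c by simp
  qed
  from this[of 1] this[of 2] this[of 3] show ?thesis
    unfolding helix_def using pos p(3) \<sigma>(2-4) by simp
qed

lemma length_double_tetra_helix: "1 \<le> k \<Longrightarrow> length (double_tetra_helix k) = 2 * k"
  by (cases k) (auto simp: double_tetra_helix_def)

lemma double_tetra_helix_nth_aux:
  assumes "2 \<le> i" "i < 2 * k"
  shows "double_tetra_helix k ! i = (i, [4, 4, 2, 1, 3, 3, 1, 2] ! ((i - 2) mod 8))"
proof -
  obtain j where j: "i = Suc (Suc j)" using assms(1) by (metis add_2_eq_Suc le_Suc_ex)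
  then have "double_tetra_helix k ! i =
      map (\<lambda>i. (i + 1, [4, 4, 2, 1, 3, 3, 1, 2] ! ((i - 1) mod 8))) [1..<2 * (k - 1) + 1] ! j"
    by (simp only: double_tetra_helix_def append_Cons append_Nil nth_Cons_Suc)
  also have "\<dots> = (i, [4, 4, 2, 1, 3, 3, 1, 2] ! ((i - 2) mod 8))"
    using assms j by (subst nth_map) (auto simp del: upt_Suc)
  finally show ?thesis .
qed

text \<open>
  The even and the odd entries of the symbol describe one branch each. Truncated subtraction lets
  the first entry of both branches refer to the first tetrahedron.
\<close>

lemma double_tetra_helix_nth:
  assumes "m < k"
  shows "\<exists>j. double_tetra_helix k ! (2 * m) = (j, [1, 4, 2, 3] ! (m mod 4)) \<and> j - 1 = 2 * m - 1"
    and "\<exists>j. double_tetra_helix k ! (2 * m + 1) = (j, [2, 4, 1, 3] ! (m mod 4)) \<and> j - 1 = 2 * m"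
proof -
  \<comment> \<open>The periodic part of the symbol begins at \<open>m = 1\<close>, hence the shift
    by one before reducing modulo 4.\<close>
  have m4: "\<exists>q r. m = r + 1 + 4 * q \<and> r \<in> {0, 1, 2, 3}" if "m \<noteq> 0"
    using that by (intro exI[of _ "(m - 1) div 4"] exI[of _ "(m - 1) mod 4"]) auto
  show "\<exists>j. double_tetra_helix k ! (2 * m) = (j, [1, 4, 2, 3] ! (m mod 4)) \<and> j - 1 = 2 * m - 1"
  proof (cases "m = 0")
    case True
    then show ?thesis by (simp add: double_tetra_helix_def)
  next
    case False
    then have "double_tetra_helix k ! (2 * m) = (2 * m, [4, 4, 2, 1, 3, 3, 1, 2] ! ((2 * m - 2) mod 8))"
      using assms by (intro double_tetra_helix_nth_aux) auto
    moreover have "[4, 4, 2, 1, 3, 3, 1, 2] ! ((2 * m - 2) mod 8) = [1, 4, 2, 3::nat] ! (m mod 4)"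
    proof -
      obtain q r where m: "m = r + 1 + 4 * q" and r: "r \<in> {0, 1, 2, 3}"
        using m4[OF False] by blast
      have "2 * m - 2 = 2 * r + 8 * q" using m by simp
      then have "(2 * m - 2) mod 8 = (2 * r) mod 8" by (simp only: mod_mult_self2)
      moreover have "m mod 4 = (r + 1) mod 4" unfolding m by (rule mod_mult_self2)
      ultimately show ?thesis using r by (elim insertE emptyE) simp_all
    qed
    ultimately show ?thesis by simp
  qed
  show "\<exists>j. double_tetra_helix k ! (2 * m + 1) = (j, [2, 4, 1, 3] ! (m mod 4)) \<and> j - 1 = 2 * m"
  proof (cases "m = 0")
    case True
    then show ?thesis by (simp add: double_tetra_helix_def)
  next
    case False
    then have "double_tetra_helix k ! (2 * m + 1) =
        (2 * m + 1, [4, 4, 2, 1, 3, 3, 1, 2] ! ((2 * m + 1 - 2) mod 8))"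
      using assms by (intro double_tetra_helix_nth_aux) auto
    moreover have "[4, 4, 2, 1, 3, 3, 1, 2] ! ((2 * m + 1 - 2) mod 8) = [2, 4, 1, 3::nat] ! (m mod 4)"
    proof -
      obtain q r where m: "m = r + 1 + 4 * q" and r: "r \<in> {0, 1, 2, 3}"
        using m4[OF False] by blast
      have "2 * m + 1 - 2 = 2 * r + 1 + 8 * q" using m by simp
      then have "(2 * m + 1 - 2) mod 8 = (2 * r + 1) mod 8" by (simp only: mod_mult_self2)
      moreover have "m mod 4 = (r + 1) mod 4" unfolding m by (rule mod_mult_self2)
      ultimately show ?thesis using r by (elim insertE emptyE) simp_all
    qed
    ultimately show ?thesis by simp
  qed
qed

section \<open>Edge lengths determined by the colours\<close>

lemma described_by_step:
  assumes "described_by ss l T c" "i < length ss" "ss ! i = (m, k)"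
  shows "\<exists>x\<in>T ! (m - 1). \<exists>y. c x = k \<and> c y = k \<and>
     y = reflect_in (affine hull (T ! (m - 1) - {x})) x \<and> T ! (i + 1) = insert y (T ! (m - 1) - {x})"
  using assms unfolding described_by_def by blast

text \<open>\<open>s\<close> and \<open>t\<close> stand for the two lengths whose assignment \<open>described_by\<close> leaves open.\<close>

definition colour_dist2 :: "real \<Rightarrow> real \<Rightarrow> real \<Rightarrow> nat set \<Rightarrow> real" where
  "colour_dist2 s b t e =
     (if e \<in> {{1, 2}, {3, 4}} then b else if e \<in> {{1, 3}, {2, 4}} then s else t)"

lemma wild_tetrahedron_colour_dist:
  assumes w: "wild_tetrahedron (a, b, d) S" and c: "bij_betw c S {1, 2, 3, 4 :: nat}"
    and b: "\<And>u w. u \<in> S \<Longrightarrow> w \<in> S \<Longrightarrow> {c u, c w} = {1, 2} \<or> {c u, c w} = {3, 4} \<Longrightarrow> dist u w = b"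
    and abd: "a \<noteq> b" "b \<noteq> d"
  obtains s t where "(s, t) = (a, d) \<or> (s, t) = (d, a)"
    "\<And>u w. u \<in> S \<Longrightarrow> w \<in> S \<Longrightarrow> u \<noteq> w \<Longrightarrow> (dist u w)\<^sup>2 = colour_dist2 (s\<^sup>2) (b\<^sup>2) (t\<^sup>2) {c u, c w}"
proof -
  have ex: "\<exists>u\<in>S. c u = j" if "j \<in> {1, 2, 3, 4}" for j
  proof -
    have "j \<in> c ` S" using c that by (simp add: bij_betw_def)
    then show ?thesis by blast
  qed
  obtain x1 where x1: "x1 \<in> S" "c x1 = 1" using ex[of 1] by auto
  obtain x2 where x2: "x2 \<in> S" "c x2 = 2" using ex[of 2] by auto
  obtain x3 where x3: "x3 \<in> S" "c x3 = 3" using ex[of 3] by auto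
  obtain x4 where x4: "x4 \<in> S" "c x4 = 4" using ex[of 4] by auto
  note x = x1(1) x2(1) x3(1) x4(1) and cx = x1(2) x2(2) x3(2) x4(2)
  have S: "S = {x1, x2, x3, x4}"
  proof
    show "S \<subseteq> {x1, x2, x3, x4}"
    proof
      fix u assume u: "u \<in> S"
      then have "c u \<in> {1, 2, 3, 4}" using c by (auto simp: bij_betw_def)
      then have "\<exists>v\<in>{x1, x2, x3, x4}. c u = c v" using cx by auto
      then show "u \<in> {x1, x2, x3, x4}"
        using u x inj_onD[OF bij_betw_imp_inj_on[OF c], of u] by auto
    qed
  qed (use x in auto)
  have ne: "x1 \<noteq> x2" "x1 \<noteq> x3" "x1 \<noteq> x4" "x2 \<noteq> x3" "x2 \<noteq> x4" "x3 \<noteq> x4" using cx by auto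
  have face: "triangle_with_sides (a, b, d) {u, v, w}"
    if "{u, v, w} \<subseteq> S" "u \<noteq> v" "u \<noteq> w" "v \<noteq> w" for u v w
    using w that unfolding wild_tetrahedron_def tet_faces_def by simp
  have d12: "dist x1 x2 = b" "dist x3 x4 = b" using b[of x1 x2] b[of x3 x4] x cx by simp_all
  note tri = triangle_with_sides_opposite[OF face _ _ _ abd]
  \<comment> \<open>The face 1, 2, 3 makes the choice, the face 1, 3, 4 passes it on to vertex 4,
    and the face 1, 2, 4 then fixes the remaining edge.\<close>
  have "dist x1 x3 = a \<and> dist x2 x3 = d \<or> dist x1 x3 = d \<and> dist x2 x3 = a"
    "dist x1 x4 = a \<and> dist x2 x4 = d \<or> dist x1 x4 = d \<and> dist x2 x4 = a"
    "dist x3 x1 = a \<and> dist x4 x1 = d \<or> dist x3 x1 = d \<and> dist x4 x1 = a"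
    using x ne d12 by (intro tri; simp)+
  then consider "dist x1 x3 = a" "dist x2 x3 = d" "dist x1 x4 = d" "dist x2 x4 = a"
    | "dist x1 x3 = d" "dist x2 x3 = a" "dist x1 x4 = a" "dist x2 x4 = d"
    by (metis dist_commute)
  then obtain s t where st: "(s, t) = (a, d) \<or> (s, t) = (d, a)"
    "dist x1 x3 = s" "dist x2 x3 = t" "dist x1 x4 = t" "dist x2 x4 = s"
    by cases blast+
  have "(dist u w)\<^sup>2 = colour_dist2 (s\<^sup>2) (b\<^sup>2) (t\<^sup>2) {c u, c w}" if "u \<in> S" "w \<in> S" "u \<noteq> w" for u w
    using that unfolding S
    by (elim insertE emptyE; simp add: colour_dist2_def doubleton_eq_iff cx st d12
        dist_commute[of x2 x1] dist_commute[of x3 x1] dist_commute[of x4 x1]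
        dist_commute[of x3 x2] dist_commute[of x4 x2] dist_commute[of x4 x3])
  then show ?thesis using that st(1) by blast
qed

text \<open>A reflected vertex inherits both the colour and the distances of the old one, so the
  assignment of lengths to colours in the first tetrahedron spreads to the whole cluster.\<close>

lemma described_by_colour_dist:
  assumes d: "described_by ss l T c" and "i < length T"
    and base: "\<And>u w. u \<in> T ! 0 \<Longrightarrow> w \<in> T ! 0 \<Longrightarrow> u \<noteq> w \<Longrightarrow> (dist u w)\<^sup>2 = D {c u, c w}"
  shows "\<forall>u\<in>T ! i. \<forall>w\<in>T ! i. u \<noteq> w \<longrightarrow> (dist u w)\<^sup>2 = D {c u, c w}"
  using \<open>i < length T\<close>
proof (induction i rule: less_induct)
  case (less i)
  show ?case
  proof (cases i)
    case 0
    then show ?thesis using base by blast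
  next
    case (Suc j)
    have len: "length T = length ss + 1" using d by (simp add: described_by_def)
    then have j: "j < length ss" using less.prems Suc by simp
    obtain m k where mk: "ss ! j = (m, k)" by force
    have "m \<le> j + 1" "1 \<le> m" using d j mk by (auto simp: described_by_def)
    then have "m - 1 < i" "m - 1 < length T" using Suc j len by auto
    note IH = less.IH[OF this]
    obtain x y where xy: "x \<in> T ! (m - 1)" "c x = k" "c y = k"
      "y = reflect_in (affine hull (T ! (m - 1) - {x})) x" "T ! i = insert y (T ! (m - 1) - {x})"
      using described_by_step[OF d j mk] Suc by auto
    have y: "(dist y w)\<^sup>2 = D {c y, c w}" if "w \<in> T ! (m - 1) - {x}" for w
    proof -
      have "dist y w = dist x w" unfolding xy(4) using that by (rule dist_reflect_in)
      then show ?thesis using IH xy that by auto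
    qed
    show ?thesis
    proof (intro ballI impI)
      fix u w assume uw: "u \<in> T ! i" "w \<in> T ! i" "u \<noteq> w"
      consider "u \<in> T ! (m - 1) - {x}" "w \<in> T ! (m - 1) - {x}" | "u = y" "w \<in> T ! (m - 1) - {x}"
        | "w = y" "u \<in> T ! (m - 1) - {x}"
        using uw unfolding xy(5) by blast
      then show "(dist u w)\<^sup>2 = D {c u, c w}"
      proof cases
        case 1
        then show ?thesis using IH uw(3) by blast
      next
        case 2
        then show ?thesis using y by blast
      next
        case 3
        then show ?thesis using y[of u] by (simp add: dist_commute insert_commute)
      qed
    qed
  qed
qed

lemma mod_4_cases: "m mod 4 = 0 \<or> m mod 4 = 1 \<or> m mod 4 = 2 \<or> m mod 4 = (3::nat)"
  by presburger

text \<open>On a cycle of four colours, steps of 1 and 3 alternate with parity between two pairs of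
  opposite edges, and steps of 2 always give the third pair. This is the parity pattern of
  \<open>helix\<close>.\<close>

lemma cyclic_colours:
  fixes \<sigma> :: "nat \<Rightarrow> nat"
  assumes \<sigma>: "\<And>m. \<sigma> m = [u, v, w, z] ! (m mod 4)" and "distinct [u, v, w, z]"
  shows "\<sigma> (m + 4) = \<sigma> m" "d \<in> {1, 2, 3} \<Longrightarrow> \<sigma> (m + d) \<noteq> \<sigma> m"
    and "{\<sigma> m, \<sigma> (m + 1)} \<in> (if even m then {{u, v}, {w, z}} else {{v, w}, {u, z}})"
    and "{\<sigma> m, \<sigma> (m + 2)} \<in> {{u, w}, {v, z}}"
    and "{\<sigma> m, \<sigma> (m + 3)} \<in> (if even m then {{v, w}, {u, z}} else {{u, v}, {w, z}})"
proof -
  have s: "\<sigma> (m + d) = [u, v, w, z] ! ((m mod 4 + d) mod 4)" for d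
    unfolding \<sigma> by (simp add: mod_add_left_eq)
  have e: "even m \<longleftrightarrow> even (m mod 4)" by presburger
  have s0: "\<sigma> m = [u, v, w, z] ! (m mod 4)" by (rule \<sigma>)
  show "\<sigma> (m + 4) = \<sigma> m" unfolding s s0 by simp
  show "d \<in> {1, 2, 3} \<Longrightarrow> \<sigma> (m + d) \<noteq> \<sigma> m"
    unfolding s s0 using assms(2) mod_4_cases[of m] by auto
  show "{\<sigma> m, \<sigma> (m + 1)} \<in> (if even m then {{u, v}, {w, z}} else {{v, w}, {u, z}})"
    "{\<sigma> m, \<sigma> (m + 2)} \<in> {{u, w}, {v, z}}"
    "{\<sigma> m, \<sigma> (m + 3)} \<in> (if even m then {{v, w}, {u, z}} else {{u, v}, {w, z}})"
    unfolding s s0 e using mod_4_cases[of m] by (auto simp: insert_commute)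
qed

lemma coloured_helix_exists:
  fixes E :: "nat \<Rightarrow> point set" and c :: "point \<Rightarrow> nat" and b :: "nat \<Rightarrow> point"
  assumes col: "distinct [u, v, w, z]"
    and inj: "\<And>m. m \<le> k \<Longrightarrow> inj_on c (E m)"
    and base: "E 0 = b ` {u, v, w, z}" "c (b u) = u" "c (b v) = v" "c (b w) = w" "c (b z) = z"
    and step: "\<And>m. m < k \<Longrightarrow> \<exists>x\<in>E m. \<exists>y. c x = [u, v, w, z] ! (m mod 4) \<and>
      c y = [u, v, w, z] ! (m mod 4) \<and> E (m + 1) = insert y (E m - {x})"
    and neq: "\<And>m. m < k \<Longrightarrow> E (m + 1) \<noteq> E m"
    and pos: "0 < X" "0 < Y" "0 < Z"
    and dist: "\<And>m x y. m \<le> k \<Longrightarrow> x \<in> E m \<Longrightarrow> y \<in> E m \<Longrightarrow> x \<noteq> y \<Longrightarrow> (dist x y)\<^sup>2 = D {c x, c y}"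
    and D: "D {u, v} = Y + Z" "D {w, z} = Y + Z" "D {v, w} = X + Y" "D {u, z} = X + Y"
      "D {u, w} = X + Z" "D {v, z} = X + Z"
  obtains p where "p 0 = b u" "p 1 = b v" "p 2 = b w" "p 3 = b z"
    "windows k p = E ` {..k}" "helix X Y Z (k + 3) p"
proof -
  define \<sigma> where "\<sigma> m = [u, v, w, z] ! (m mod 4)" for m
  note cyc = cyclic_colours[OF \<sigma>_def col]
  have \<sigma>4: "\<sigma> 0 = u" "\<sigma> 1 = v" "\<sigma> 2 = w" "\<sigma> 3 = z" by (simp_all add: \<sigma>_def)
  have le3: "j = 0 \<or> j = 1 \<or> j = 2 \<or> j = 3" if "j \<le> 3" for j :: nat using that by linarith
  have "{0..3} = {0, 1, 2, 3::nat}" by auto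
  then have "E 0 = (\<lambda>j. b (\<sigma> j)) ` {0..3}" by (simp only: base(1) image_insert image_empty \<sigma>4)
  moreover have "c (b (\<sigma> j)) = \<sigma> j" if "j \<le> 3" for j
    using le3[OF that] base(2-5) \<sigma>4 by auto
  ultimately obtain p where p: "\<And>j. j \<le> 3 \<Longrightarrow> p j = b (\<sigma> j)" "\<And>m. m \<le> k \<Longrightarrow> E m = p ` {m..m + 3}"
      "\<And>j. j \<le> k + 3 \<Longrightarrow> c (p j) = \<sigma> j" "\<And>j. j + 4 \<le> k + 3 \<Longrightarrow> p (j + 4) \<noteq> p j"
    using branch_exists[where k = k and c = c and E = E and b = "\<lambda>j. b (\<sigma> j)" and \<sigma> = \<sigma>,
        OF inj _ _ step[folded \<sigma>_def] neq cyc(1,2)]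
    by blast
  have "helix X Y Z (k + 3) p"
  proof (rule helix_of_branch[OF pos p(2,3,4) dist cyc(2)])
    fix m
    show "D {\<sigma> m, \<sigma> (m + 1)} = (if even m then Y + Z else X + Y)"
      using cyc(3)[of m] D by (auto split: if_splits)
    show "D {\<sigma> m, \<sigma> (m + 2)} = X + Z" using cyc(4)[of m] D by auto
    show "D {\<sigma> m, \<sigma> (m + 3)} = (if even m then X + Y else Y + Z)"
      using cyc(5)[of m] D by (auto split: if_splits)
  qed
  moreover have "windows k p = E ` {..k}"
    unfolding windows_def using p(2) by (intro image_cong) auto
  moreover have "p 0 = b u" "p 1 = b v" "p 2 = b w" "p 3 = b z"
    using p(1) \<sigma>4 by simp_all
  ultimately show ?thesis using that by blast
qed

text \<open>The assignment of two of the lengths that \<open>described_by\<close> leaves open has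
  two cases. They differ by exchanging the box sides \<open>A\<close> and \<open>C\<close> along
  both branches, which amounts to letting \<open>p\<close> and \<open>q\<close> change
  places.\<close>

lemma double_tetra_helix_T1:
  fixes A B C :: real and T :: "point set list" and \<phi> :: "point \<Rightarrow> point"
  defines "S \<equiv> 1 / A + 1 / B + 1 / C"
  defines "x \<equiv> 4 / (S * A)" and "y \<equiv> 4 / (S * C)"
  assumes d: "described_by (double_tetra_helix (6 * n + 5)) (l1, l2, l3) T c"
    and pos: "0 < A" "0 < B" "0 < C"
    and l: "l1\<^sup>2 = B + C" "l2\<^sup>2 = A + C" "l3\<^sup>2 = A + B" "l1 \<noteq> l2" "l2 \<noteq> l3"
    and xy: "reciprocal_weights x y" "774 / 1000 \<le> x" "x \<le> 775 / 1000"
    and iso: "\<And>S u w. S \<in> set T \<Longrightarrow> u \<in> S \<Longrightarrow> w \<in> S \<Longrightarrow> dist (\<phi> u) (\<phi> w) = dist u w"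
    and inj: "inj_on \<phi> (vertices (multi_tetrahedral_sphere T))"
  shows "\<exists>v w fv fw. property_T1 (multi_tetrahedral_sphere T) v w fv fw \<phi>"
proof -
  define k where "k = 6 * n + 5"
  define ss where "ss = double_tetra_helix k"
  have d: "described_by ss (l1, l2, l3) T c" using d by (simp add: ss_def k_def)
  have lss: "length ss = 2 * k" by (simp add: ss_def length_double_tetra_helix k_def)
  have lT: "length T = 2 * k + 1" and dT: "distinct T"
    using d lss by (auto simp: described_by_def wild_cluster_def)
  have c: "bij_betw c (T ! i) {1, 2, 3, 4}" if "i < length T" for i
    using d that by (auto simp: described_by_def tetra_colouring_def)
  have T0: "T ! 0 \<in> set T" using lT by simp
  have w0: "wild_tetrahedron (l1, l2, l3) (T ! 0)"
    using d T0 by (simp add: described_by_def)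
  have b0: "dist u w = l2"
    if "u \<in> T ! 0" "w \<in> T ! 0" "{c u, c w} = {1, 2} \<or> {c u, c w} = {3, 4}" for u w
  proof -
    have "\<forall>S\<in>set T. \<forall>x\<in>S. \<forall>y\<in>S. {c x, c y} = {1, 2} \<or> {c x, c y} = {3, 4} \<longrightarrow> dist x y = l2"
      using d unfolding described_by_def fst_conv snd_conv by blast
    then show ?thesis using T0 that by blast
  qed
  have c0: "bij_betw c (T ! 0) {1, 2, 3, 4}" using c[of 0] lT by simp
  obtain s t where st: "(s, t) = (l1, l3) \<or> (s, t) = (l3, l1)"
    and D0: "\<And>u w. u \<in> T ! 0 \<Longrightarrow> w \<in> T ! 0 \<Longrightarrow> u \<noteq> w \<Longrightarrow>
        (dist u w)\<^sup>2 = colour_dist2 (s\<^sup>2) (l2\<^sup>2) (t\<^sup>2) {c u, c w}"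
    using wild_tetrahedron_colour_dist[OF w0 c0 b0 l(4,5)] by metis
  define D where "D = colour_dist2 (s\<^sup>2) (l2\<^sup>2) (t\<^sup>2)"
  have D: "(dist u w)\<^sup>2 = D {c u, c w}" if "i < length T" "u \<in> T ! i" "w \<in> T ! i" "u \<noteq> w" for i u w
    using described_by_colour_dist[OF d that(1) D0] that(2-4) unfolding D_def by blast
  \<comment> \<open>After the first tetrahedron the list alternates between the branches. By
    truncated subtraction \<open>E 0\<close> is \<open>T ! 0\<close>, so both branches start
    there.\<close>
  define E Q where "E m = T ! (2 * m - 1)" and "Q m = T ! (2 * m)" for m
  define b where "b = inv_into (T ! 0) c"
  have b: "b ` {1, 2, 3, 4} = T ! 0" "\<And>j. j \<in> {1, 2, 3, 4} \<Longrightarrow> c (b j) = j"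
    using c0 unfolding b_def bij_betw_def
    by (metis inv_into_image_cancel subset_refl, metis f_inv_into_f)
  have b4: "c (b 1) = 1" "c (b 2) = 2" "c (b 3) = 3" "c (b 4) = 4" using b(2) by simp_all
  have colours: "{1, 4, 2, 3} = {1, 2, 3, 4::nat}" "{2, 4, 1, 3} = {1, 2, 3, 4::nat}" by auto
  have stepE: "\<exists>x\<in>E m. \<exists>y. c x = [1, 4, 2, 3] ! (m mod 4) \<and> c y = [1, 4, 2, 3] ! (m mod 4) \<and>
      E (m + 1) = insert y (E m - {x})" if m: "m < k" for m
  proof -
    obtain j where j: "ss ! (2 * m) = (j, [1, 4, 2, 3] ! (m mod 4))" "j - 1 = 2 * m - 1"
      using double_tetra_helix_nth(1)[OF m] unfolding ss_def by blast
    have "2 * (m + 1) - 1 = 2 * m + 1" by simp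
    then show ?thesis
      using described_by_step[OF d _ j(1)] lss m unfolding j(2) E_def by auto
  qed
  have stepO: "\<exists>x\<in>Q m. \<exists>y. c x = [2, 4, 1, 3] ! (m mod 4) \<and> c y = [2, 4, 1, 3] ! (m mod 4) \<and>
      Q (m + 1) = insert y (Q m - {x})" if m: "m < k" for m
  proof -
    obtain j where j: "ss ! (2 * m + 1) = (j, [2, 4, 1, 3] ! (m mod 4))" "j - 1 = 2 * m"
      using double_tetra_helix_nth(2)[OF m] unfolding ss_def by blast
    have "2 * (m + 1) = 2 * m + 1 + 1" by simp
    then show ?thesis
      using described_by_step[OF d _ j(1)] lss m unfolding j(2) Q_def by auto
  qed
  have neq: "E (m + 1) \<noteq> E m" "Q (m + 1) \<noteq> Q m" if "m < k" for m
    using that lT dT by (simp_all add: E_def Q_def nth_eq_iff_index_eq)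
  have injc: "inj_on c (E m)" "inj_on c (Q m)" if "m \<le> k" for m
    using c[of "2 * m - 1"] c[of "2 * m"] that lT
    by (auto simp: E_def Q_def bij_betw_def)
  have dist: "x \<in> E m \<Longrightarrow> y \<in> E m \<Longrightarrow> x \<noteq> y \<Longrightarrow> (dist x y)\<^sup>2 = D {c x, c y}"
    "x \<in> Q m \<Longrightarrow> y \<in> Q m \<Longrightarrow> x \<noteq> y \<Longrightarrow> (dist x y)\<^sup>2 = D {c x, c y}" if "m \<le> k" for m x y
    using D[of "2 * m - 1" x y] D[of "2 * m" x y] that lT by (simp_all add: E_def Q_def)
  have Dv: "D {1, 4} = t\<^sup>2" "D {2, 3} = t\<^sup>2" "D {4, 1} = t\<^sup>2" "D {4, 2} = s\<^sup>2" "D {2, 4} = s\<^sup>2" "D {1, 3} = s\<^sup>2"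
    "D {1, 2} = l2\<^sup>2" "D {2, 1} = l2\<^sup>2" "D {4, 3} = l2\<^sup>2"
    by (simp_all add: D_def colour_dist2_def doubleton_eq_iff)
  have E0: "E 0 = b ` {1, 4, 2, 3}" and O0: "Q 0 = b ` {2, 4, 1, 3}"
    unfolding colours b by (simp_all add: E_def Q_def)
  \<comment> \<open>The box sides remain parameters, since the two assignments of lengths
    instantiate them in opposite order.\<close>
  have even: thesis
    if "0 < X" "0 < Y" "0 < Z" "t\<^sup>2 = Y + Z" "s\<^sup>2 = X + Y" "l2\<^sup>2 = X + Z"
      "\<And>p. p 0 = b 1 \<Longrightarrow> p 1 = b 4 \<Longrightarrow> p 2 = b 2 \<Longrightarrow> p 3 = b 3 \<Longrightarrow> windows k p = E ` {..k} \<Longrightarrow>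
        helix X Y Z (k + 3) p \<Longrightarrow> thesis" for X Y Z thesis
    by (rule coloured_helix_exists[of 1 4 2 3 k c E b X Y Z D])
      (use that injc E0 b4 stepE neq dist Dv in \<open>simp_all\<close>)
  have odd: thesis
    if "0 < X" "0 < Y" "0 < Z" "s\<^sup>2 = Y + Z" "t\<^sup>2 = X + Y" "l2\<^sup>2 = X + Z"
      "\<And>p. p 0 = b 2 \<Longrightarrow> p 1 = b 4 \<Longrightarrow> p 2 = b 1 \<Longrightarrow> p 3 = b 3 \<Longrightarrow> windows k p = Q ` {..k} \<Longrightarrow>
        helix X Y Z (k + 3) p \<Longrightarrow> thesis" for X Y Z thesis
    by (rule coloured_helix_exists[of 2 4 1 3 k c Q b X Y Z D])
      (use that injc O0 b4 stepO neq dist Dv in \<open>simp_all\<close>)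
  have setT: "set T = E ` {..k} \<union> Q ` {..k}"
  proof -
    have "i < length T \<longleftrightarrow> (\<exists>m\<le>k. i = 2 * m - 1) \<or> (\<exists>m\<le>k. i = 2 * m)" for i
      unfolding lT by presburger
    then show ?thesis by (auto simp: set_conv_nth E_def Q_def image_iff)
  qed
  note T1 = helices_T1[of T n, folded k_def, OF dT]
  note xy = xy[unfolded x_def y_def S_def]
  from st show ?thesis
  proof
    assume "(s, t) = (l1, l3)"
    then have st: "s\<^sup>2 = B + C" "t\<^sup>2 = A + B" using l by simp_all
    obtain p where p: "p 0 = b 1" "p 1 = b 4" "p 2 = b 2" "p 3 = b 3" "windows k p = E ` {..k}"
        "helix C B A (k + 3) p"
      by (rule even[of C B A]) (use pos st l(2) in \<open>simp_all add: add.commute\<close>)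
    obtain q where q: "q 0 = b 2" "q 1 = b 4" "q 2 = b 1" "q 3 = b 3" "windows k q = Q ` {..k}"
        "helix A B C (k + 3) q"
      by (rule odd[of A B C]) (use pos st l(2) in \<open>simp_all add: add.commute\<close>)
    have "set T = windows k p \<union> windows k q" using setT p(5) q(5) by simp
    from T1[OF this p(6) q(6) _ _ _ _ xy iso inj] show ?thesis using p q by simp
  next
    assume "(s, t) = (l3, l1)"
    then have st: "t\<^sup>2 = B + C" "s\<^sup>2 = A + B" using l by simp_all
    obtain q where q: "q 0 = b 1" "q 1 = b 4" "q 2 = b 2" "q 3 = b 3" "windows k q = E ` {..k}"
        "helix A B C (k + 3) q"
      by (rule even[of A B C]) (use pos st l(2) in \<open>simp_all add: add.commute\<close>)
    obtain p where p: "p 0 = b 2" "p 1 = b 4" "p 2 = b 1" "p 3 = b 3" "windows k p = Q ` {..k}"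
        "helix C B A (k + 3) p"
      by (rule odd[of C B A]) (use pos st l(2) in \<open>simp_all add: add.commute\<close>)
    have "set T = windows k p \<union> windows k q" using setT p(5) q(5) by auto
    from T1[OF this p(6) q(6) _ _ _ _ xy iso inj] show ?thesis using p q by simp
  qed
qed

section \<open>The weights belonging to the given root\<close>

text \<open>For the given edge lengths the box has squared sides 1, \<open>r / (r + 1)\<close> and \<open>1 / (r + 1)\<close>.\<close>

lemma weights_of_root:
  fixes r :: real
  assumes "r ^ 4 - 10 * r ^ 3 - 5 * r ^ 2 + 6 * r + 1 = 0" "175013 / 262144 \<le> r" "r \<le> 21877 / 32768"
  defines "S \<equiv> 1 / 1 + 1 / (r / (r + 1)) + 1 / (1 / (r + 1))"
  shows "reciprocal_weights (4 / (S * 1)) (4 / (S * (1 / (r + 1))))"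
    and "774 / 1000 \<le> 4 / (S * 1)" "4 / (S * 1) \<le> 775 / 1000"
proof -
  define D where "D = r\<^sup>2 + 3 * r + 1"
  have r: "0 < r" using assms(2) by simp
  have D: "0 < D" using r by (simp add: D_def add_pos_pos)
  have S: "S = D / r" using r by (simp add: S_def D_def field_simps power2_eq_square)
  have x: "4 / (S * 1) = 4 * r / D" and y: "4 / (S * (1 / (r + 1))) = 4 * r * (r + 1) / D"
    using r D by (simp_all add: S)
  have r2: "(175013 / 262144)\<^sup>2 \<le> r\<^sup>2" "r\<^sup>2 \<le> (21877 / 32768)\<^sup>2"
    using assms(2,3) by (intro power_mono; simp)+
  \<comment> \<open>The difference of the two sides expands to the quartic: this is where the
    polynomial comes from.\<close>
  have "4 * r * (4 * r * (r + 1)) = D * D"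
    using assms(1) unfolding D_def by algebra
  then have xy: "(4 * r / D) * (4 * r * (r + 1) / D) = 1" using D by simp
  show lo: "774 / 1000 \<le> 4 / (S * 1)"
    unfolding x using D assms(2,3) r2 by (simp add: D_def field_simps)
  show up: "4 / (S * 1) \<le> 775 / 1000"
    unfolding x using D assms(2,3) r2 by (simp add: D_def field_simps)
  \<comment> \<open>After clearing \<open>D\<close>, the lower bound reads
    \<open>r\<^sup>2 + r > 1\<close>, which the interval provides.\<close>
  have "4 * r / D + 4 * r * (r + 1) / D < 21 / 10" "2 < 4 * r / D + 4 * r * (r + 1) / D"
    unfolding add_divide_distrib[symmetric]
    using D assms(2,3) r2 by (simp_all add: D_def field_simps power2_eq_square)
  then show "reciprocal_weights (4 / (S * 1)) (4 / (S * (1 / (r + 1))))"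
    unfolding reciprocal_weights_def x y using r D xy by simp
qed

theorem mainTheorem6:
  fixes r1 r2 :: real and l :: "real \<times> real \<times> real" and n :: nat
    and T :: "point set list" and c :: "point \<Rightarrow> nat"
    and X :: "point set set" and \<omega> :: "point set \<Rightarrow> nat" and \<phi> :: "point \<Rightarrow> point"
  assumes "r1 ^ 4 - 10 * r1 ^ 3 - 5 * r1 ^ 2 + 6 * r1 + 1 = 0"
    and "r1 \<in> {175013 / 262144 .. 21877 / 32768}"
    and "r2 = sqrt r1"
    and "l = (1, sqrt (1 + 1 / (r2 ^ 2 + 1)), sqrt (1 + r2 ^ 2 / (r2 ^ 2 + 1)))"
    and "described_by (double_tetra_helix (5 + 6 * n)) l T c"
    and "X = multi_tetrahedral_sphere T"
    and "wild_coloured_by_lengths X l \<omega>"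
    and "strong_embedding X \<omega> l \<phi>"
  shows "\<exists>v w fv fw. property_T1 X v w fv fw \<phi>"
proof -
  \<comment> \<open>The solution of \<open>B + C = 1\<close>, with \<open>A + C\<close> and
    \<open>A + B\<close> the squares of the second and third length.\<close>
  define A B C where "A = (1::real)" and "B = r1 / (r1 + 1)" and "C = 1 / (r1 + 1)"
  have r1: "0 < r1" "r1 < 1" and bounds: "175013 / 262144 \<le> r1" "r1 \<le> 21877 / 32768"
    using assms(2) by auto
  have pos: "0 < A" "0 < B" "0 < C" using r1 by (simp_all add: A_def B_def C_def)
  have BC: "B + C = 1" "B \<noteq> C" using r1 by (simp_all add: B_def C_def field_simps)
  have l: "l = (1, sqrt (A + C), sqrt (A + B))"
    using r1 unfolding assms(3,4) A_def B_def C_def by simp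
  have sq: "(1::real)\<^sup>2 = B + C" "(sqrt (A + C))\<^sup>2 = A + C" "(sqrt (A + B))\<^sup>2 = A + B"
    using pos BC by simp_all
  have ne: "1 \<noteq> sqrt (A + C)" "sqrt (A + C) \<noteq> sqrt (A + B)"
    using pos BC by (simp_all add: A_def)
  define S where "S = 1 / A + 1 / B + 1 / C"
  have weights: "reciprocal_weights (4 / (S * A)) (4 / (S * C))"
    "774 / 1000 \<le> 4 / (S * A)" "4 / (S * A) \<le> 775 / 1000"
    using weights_of_root[OF assms(1) bounds] unfolding S_def A_def B_def C_def .
  \<comment> \<open>The sphere keeps the edges of glued faces as well, so every pair of vertices of
    a tetrahedron has a prescribed distance.\<close>
  have iso: "dist (\<phi> u) (\<phi> w) = dist u w" if "S \<in> set T" "u \<in> S" "w \<in> S" for S u w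
  proof (cases "u = w")
    case False
    then have "{u, w} \<in> edges X"
      using that unfolding assms(6) edges_multi_tetrahedral_sphere by auto
    then show ?thesis
      using assms(7,8) by (auto simp: wild_coloured_by_lengths_def strong_embedding_def
          has_edge_lengths_def dist_norm)
  qed simp
  have "described_by (double_tetra_helix (6 * n + 5)) (1, sqrt (A + C), sqrt (A + B)) T c"
    using assms(5) unfolding l by (simp add: add.commute)
  from double_tetra_helix_T1[OF this pos sq ne weights[unfolded S_def] iso] assms(6,8)
  show ?thesis by (simp add: strong_embedding_def)
qed

end
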